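(* Let $q\in\mathbb{C}\setminus\{0\}$ and let $\Lambda\ge2$ be an integer. Let $S_1\subseteq S_2\subseteq\cdots\subseteq S_{\Lambda-1}\subseteq\mathbb{C}$ satisfy: (1) for all $k,\ell\in\{1,\dots,\Lambda-1\}$ and all $a\in S_k$, $b\in S_\ell$: $q+a+b\neq0$ and $a\bowtie_q b\in S_{\min(k,\ell)}$; (2) for all $k,\ell\ge1$ with $k+\ell\le\Lambda-1$ and all $a\in S_k$, $b\in S_\ell$: $a\| b\in S_{k+\ell}$. Let $(G,s,t)$ be any 2-terminal series-parallel graph with a maximal decomposition tree in which every proper constituent $(H,a,b)$ has $\lambda_H(a,b)\le\Lambda-1$, and give $G$ complex edge weights $v_e\in S_1$. Then for every node $(H,a,b)$ of the tree with $\lambda_H(a,b)\le\Lambda-1$, we have $A_{H,a,b}(q,\mathbf v)\neq0$ and $v_{\rm eff}(H,a,b)=B_{H,a,b}(q,\mathbf v)/A_{H,a,b}(q,\mathbf v)\in S_{\lambda_H(a,b)}$. If moreover (3) $-q\notin S_{\Lambda-1}$ and (4) $-q\notin\{a\|b: a\in S_k, b\in S_\ell\}$ for all $k,\ell\ge1$ with $k+\ell=\Lambda$, then for every loopless series-parallel graph $G$ with maxmaxflow at most $\Lambda$ and every choice of edge weights with $v_e\in S_1$ for all edges $e$, we have $Z_G(q,\mathbf v)\neq0$.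
   Context: For $a,b\in\mathbb C$: $a\|b=(1+a)(1+b)-1$ (parallel connection), and $a\bowtie_q b=ab/(q+a+b)$ when $q+a+b\ne0$ (series connection). Multivariate Tutte polynomial: $Z_G(q,\mathbf v)=\sum_{A\subseteq E}q^{k(A)}\prod_{e\in A}v_e$, $k(A)$ = number of components of $(V,A)$. $\lambda_G(x,y)$ = maximum number of edge-disjoint $x$–$y$ paths; maxmaxflow $\Lambda(G)=\max_{x\neq y}\lambda_G(x,y)$ (0 if fewer than two vertices). A loopless graph is series-parallel if obtainable from a forest by finitely many operations replacing an edge by two edges in series or two parallel edges. A 2-terminal graph $(G,s,t)$ has distinct terminals $s,t$; parallel composition identifies $s_2$ with $s_1$ and $t_2$ with $t_1$ (terminals $s_1,t_1$); series composition identifies $t_1$ with $s_2$ (terminals $s_1,t_2$). A 2-terminal graph is 2-terminal series-parallel if it is $K_2$ or the series or parallel composition of two smaller 2-terminal series-parallel graphs. Partial polynomials: $A_{G,s,t}=q^{-2}\sum q^{k(A)}\prod_{e\in A}v_e$ over $A$ not connecting $s$ to $t$, $B_{G,s,t}=q^{-1}\sum q^{k(A)}\prod_{e\in A}v_e$ over $A$ connecting $s$ to $t$. A decomposition tree of $(G,s,t)$ (with $G$ connected, loopless) is a rooted tree with every node having 0 or 2 children, each node a connected 2-terminal graph whose underlying graph is a subgraph of $G$, root $(G,s,t)$, and each non-leaf node equal to the series composition ($s$-node, children ordered) or parallel composition ($p$-node) of its two children; nodes are called constituents, proper if not the root. A 2-terminal graph is prime if it is not the series or parallel composition of two strictly smaller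 2-terminal graphs; a decomposition tree is maximal if all its leaves are prime (for 2-terminal series-parallel graphs, the leaves of a maximal decomposition tree are then single edges). *)

theory Defs
  imports Complex_Main
begin

(* Multigraphs: vertex set V :: 'v set, edge set E :: 'e set, and an endpoint map
   ends :: 'e => 'v set (ends e = {x,y}; a loop has ends e = {x}). *)

definition par_conn :: "complex \<Rightarrow> complex \<Rightarrow> complex" where
  "par_conn a b = (1 + a) * (1 + b) - 1"

definition ser_conn :: "complex \<Rightarrow> complex \<Rightarrow> complex \<Rightarrow> complex" where
  "ser_conn q a b = a * b / (q + a + b)"

definition wf_graph :: "'v set \<Rightarrow> 'e set \<Rightarrow> ('e \<Rightarrow> 'v set) \<Rightarrow> bool" where
  "wf_graph V E ends \<longleftrightarrow> finite V \<and> finite E \<and>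
     (\<forall>e\<in>E. ends e \<subseteq> V \<and> (card (ends e) = 1 \<or> card (ends e) = 2))"

definition loopless :: "'e set \<Rightarrow> ('e \<Rightarrow> 'v set) \<Rightarrow> bool" where
  "loopless E ends \<longleftrightarrow> (\<forall>e\<in>E. card (ends e) = 2)"

definition adj :: "'e set \<Rightarrow> ('e \<Rightarrow> 'v set) \<Rightarrow> ('v \<times> 'v) set" where
  "adj E ends = {(x, y). \<exists>e\<in>E. ends e = {x, y}}"

definition reach :: "'e set \<Rightarrow> ('e \<Rightarrow> 'v set) \<Rightarrow> 'v \<Rightarrow> 'v \<Rightarrow> bool" where
  "reach A ends x y \<longleftrightarrow> (x, y) \<in> (adj A ends)\<^sup>*"

definition ncomp :: "'v set \<Rightarrow> 'e set \<Rightarrow> ('e \<Rightarrow> 'v set) \<Rightarrow> nat" where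
  "ncomp V A ends = card ((\<lambda>x. {y \<in> V. reach A ends x y}) ` V)"

definition connected_graph :: "'v set \<Rightarrow> 'e set \<Rightarrow> ('e \<Rightarrow> 'v set) \<Rightarrow> bool" where
  "connected_graph V E ends \<longleftrightarrow> V \<noteq> {} \<and> (\<forall>x\<in>V. \<forall>y\<in>V. reach E ends x y)"

definition tutte :: "'v set \<Rightarrow> 'e set \<Rightarrow> ('e \<Rightarrow> 'v set) \<Rightarrow> complex \<Rightarrow> ('e \<Rightarrow> complex) \<Rightarrow> complex" where
  "tutte V E ends q v = (\<Sum>A\<in>Pow E. q ^ ncomp V A ends * (\<Prod>e\<in>A. v e))"

definition partA :: "'v set \<Rightarrow> 'e set \<Rightarrow> ('e \<Rightarrow> 'v set) \<Rightarrow> 'v \<Rightarrow> 'v \<Rightarrow> complex \<Rightarrow> ('e \<Rightarrow> complex) \<Rightarrow> complex" where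
  "partA V E ends s t q v = (1 / q ^ 2) *
     (\<Sum>A\<in>{A. A \<subseteq> E \<and> \<not> reach A ends s t}. q ^ ncomp V A ends * (\<Prod>e\<in>A. v e))"

definition partB :: "'v set \<Rightarrow> 'e set \<Rightarrow> ('e \<Rightarrow> 'v set) \<Rightarrow> 'v \<Rightarrow> 'v \<Rightarrow> complex \<Rightarrow> ('e \<Rightarrow> complex) \<Rightarrow> complex" where
  "partB V E ends s t q v = (1 / q) *
     (\<Sum>A\<in>{A. A \<subseteq> E \<and> reach A ends s t}. q ^ ncomp V A ends * (\<Prod>e\<in>A. v e))"

definition is_path :: "'e set \<Rightarrow> ('e \<Rightarrow> 'v set) \<Rightarrow> 'v \<Rightarrow> 'v \<Rightarrow> 'v list \<Rightarrow> 'e list \<Rightarrow> bool" where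
  "is_path E ends a b vs es \<longleftrightarrow> vs \<noteq> [] \<and> hd vs = a \<and> last vs = b \<and> distinct vs \<and>
     length vs = Suc (length es) \<and>
     (\<forall>i<length es. es ! i \<in> E \<and> ends (es ! i) = {vs ! i, vs ! Suc i})"

definition edge_disjoint_paths :: "'e set \<Rightarrow> ('e \<Rightarrow> 'v set) \<Rightarrow> 'v \<Rightarrow> 'v \<Rightarrow> nat \<Rightarrow> bool" where
  "edge_disjoint_paths E ends a b k \<longleftrightarrow>
     (\<exists>P :: nat \<Rightarrow> 'v list \<times> 'e list.
        (\<forall>i<k. is_path E ends a b (fst (P i)) (snd (P i))) \<and>
        (\<forall>i<k. \<forall>j<k. i \<noteq> j \<longrightarrow> set (snd (P i)) \<inter> set (snd (P j)) = {}))"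

definition lambda :: "'e set \<Rightarrow> ('e \<Rightarrow> 'v set) \<Rightarrow> 'v \<Rightarrow> 'v \<Rightarrow> nat" where
  "lambda E ends a b = Max {k. edge_disjoint_paths E ends a b k}"

definition maxmaxflow :: "'v set \<Rightarrow> 'e set \<Rightarrow> ('e \<Rightarrow> 'v set) \<Rightarrow> nat" where
  "maxmaxflow V E ends =
     (if card V < 2 then 0 else Max {lambda E ends x y | x y. x \<in> V \<and> y \<in> V \<and> x \<noteq> y})"

definition forest :: "'v set \<Rightarrow> 'e set \<Rightarrow> ('e \<Rightarrow> 'v set) \<Rightarrow> bool" where
  "forest V E ends \<longleftrightarrow> wf_graph V E ends \<and> loopless E ends \<and>
     (\<forall>e\<in>E. \<forall>x y. ends e = {x, y} \<longrightarrow> \<not> reach (E - {e}) ends x y)"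

inductive sp_derived :: "'v set \<Rightarrow> 'e set \<Rightarrow> ('e \<Rightarrow> 'v set) \<Rightarrow> bool" where
  sp_forest: "forest V E ends \<Longrightarrow> sp_derived V E ends"
| sp_series: "\<lbrakk>sp_derived V E ends; e \<in> E; ends e = {x, y}; w \<notin> V;
     e1 \<notin> E - {e}; e2 \<notin> E - {e}; e1 \<noteq> e2\<rbrakk>
   \<Longrightarrow> sp_derived (insert w V) ((E - {e}) \<union> {e1, e2}) (ends(e1 := {x, w}, e2 := {w, y}))"
| sp_parallel: "\<lbrakk>sp_derived V E ends; e \<in> E;
     e1 \<notin> E - {e}; e2 \<notin> E - {e}; e1 \<noteq> e2\<rbrakk>
   \<Longrightarrow> sp_derived V ((E - {e}) \<union> {e1, e2}) (ends(e1 := ends e, e2 := ends e))"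

definition series_parallel :: "'v set \<Rightarrow> 'e set \<Rightarrow> ('e \<Rightarrow> 'v set) \<Rightarrow> bool" where
  "series_parallel V E ends \<longleftrightarrow> loopless E ends \<and>
     (\<exists>ends'. sp_derived V E ends' \<and> (\<forall>e\<in>E. ends' e = ends e))"

(* 2-terminal graphs are represented as (V, E, s, t) inside an ambient endpoint map;
   compositions of two pieces are realised as unions of the two (embedded) pieces. *)
type_synonym ('v, 'e) tgraph = "'v set \<times> 'e set \<times> 'v \<times> 'v"

definition two_terminal :: "('e \<Rightarrow> 'v set) \<Rightarrow> ('v, 'e) tgraph \<Rightarrow> bool" where
  "two_terminal ends X = (case X of (V, E, s, t) \<Rightarrow>
     s \<noteq> t \<and> s \<in> V \<and> t \<in> V \<and> wf_graph V E ends)"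

definition is_ser :: "('v, 'e) tgraph \<Rightarrow> ('v, 'e) tgraph \<Rightarrow> ('v, 'e) tgraph \<Rightarrow> bool" where
  "is_ser X X1 X2 = (case X of (V, E, s, t) \<Rightarrow> case X1 of (V1, E1, s1, t1) \<Rightarrow>
     case X2 of (V2, E2, s2, t2) \<Rightarrow>
       s = s1 \<and> t1 = s2 \<and> t = t2 \<and> V = V1 \<union> V2 \<and> E = E1 \<union> E2 \<and>
       V1 \<inter> V2 = {t1} \<and> E1 \<inter> E2 = {})"

definition is_par :: "('v, 'e) tgraph \<Rightarrow> ('v, 'e) tgraph \<Rightarrow> ('v, 'e) tgraph \<Rightarrow> bool" where
  "is_par X X1 X2 = (case X of (V, E, s, t) \<Rightarrow> case X1 of (V1, E1, s1, t1) \<Rightarrow>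
     case X2 of (V2, E2, s2, t2) \<Rightarrow>
       s1 = s \<and> t1 = t \<and> s2 = s \<and> t2 = t \<and> V = V1 \<union> V2 \<and> E = E1 \<union> E2 \<and>
       V1 \<inter> V2 = {s, t} \<and> E1 \<inter> E2 = {})"

inductive tsp :: "('e \<Rightarrow> 'v set) \<Rightarrow> ('v, 'e) tgraph \<Rightarrow> bool" for ends where
  tsp_K2: "\<lbrakk>s \<noteq> t; ends e = {s, t}\<rbrakk> \<Longrightarrow> tsp ends ({s, t}, {e}, s, t)"
| tsp_ser: "\<lbrakk>tsp ends X1; tsp ends X2; is_ser X X1 X2\<rbrakk> \<Longrightarrow> tsp ends X"
| tsp_par: "\<lbrakk>tsp ends X1; tsp ends X2; is_par X X1 X2\<rbrakk> \<Longrightarrow> tsp ends X"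

definition strictly_smaller :: "('v, 'e) tgraph \<Rightarrow> ('v, 'e) tgraph \<Rightarrow> bool" where
  "strictly_smaller X1 X = (case X1 of (V1, E1, _, _) \<Rightarrow> case X of (V, E, _, _) \<Rightarrow>
     V1 \<subseteq> V \<and> E1 \<subseteq> E \<and> (V1, E1) \<noteq> (V, E))"

definition prime_tg :: "('e \<Rightarrow> 'v set) \<Rightarrow> ('v, 'e) tgraph \<Rightarrow> bool" where
  "prime_tg ends X \<longleftrightarrow> \<not> (\<exists>X1 X2. two_terminal ends X1 \<and> two_terminal ends X2 \<and>
      strictly_smaller X1 X \<and> strictly_smaller X2 X \<and> (is_ser X X1 X2 \<or> is_par X X1 X2))"

datatype 'a dtree = DLeaf 'a | DSer 'a "'a dtree" "'a dtree" | DPar 'a "'a dtree" "'a dtree"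

fun lab :: "'a dtree \<Rightarrow> 'a" where
  "lab (DLeaf x) = x"
| "lab (DSer x _ _) = x"
| "lab (DPar x _ _) = x"

fun nodes :: "'a dtree \<Rightarrow> 'a set" where
  "nodes (DLeaf x) = {x}"
| "nodes (DSer x l r) = insert x (nodes l \<union> nodes r)"
| "nodes (DPar x l r) = insert x (nodes l \<union> nodes r)"

fun proper_nodes :: "'a dtree \<Rightarrow> 'a set" where
  "proper_nodes (DLeaf x) = {}"
| "proper_nodes (DSer x l r) = nodes l \<union> nodes r"
| "proper_nodes (DPar x l r) = nodes l \<union> nodes r"

fun leaves :: "'a dtree \<Rightarrow> 'a set" where
  "leaves (DLeaf x) = {x}"
| "leaves (DSer x l r) = leaves l \<union> leaves r"
| "leaves (DPar x l r) = leaves l \<union> leaves r"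

definition constituent :: "('e \<Rightarrow> 'v set) \<Rightarrow> 'v set \<Rightarrow> 'e set \<Rightarrow> ('v, 'e) tgraph \<Rightarrow> bool" where
  "constituent ends V E X = (case X of (Vh, Eh, a, b) \<Rightarrow>
     two_terminal ends X \<and> Vh \<subseteq> V \<and> Eh \<subseteq> E \<and> connected_graph Vh Eh ends)"

fun wf_dtree :: "('e \<Rightarrow> 'v set) \<Rightarrow> 'v set \<Rightarrow> 'e set \<Rightarrow> ('v, 'e) tgraph dtree \<Rightarrow> bool" where
  "wf_dtree ends V E (DLeaf x) = constituent ends V E x"
| "wf_dtree ends V E (DSer x l r) = (constituent ends V E x \<and> is_ser x (lab l) (lab r) \<and>
     wf_dtree ends V E l \<and> wf_dtree ends V E r)"
| "wf_dtree ends V E (DPar x l r) = (constituent ends V E x \<and> is_par x (lab l) (lab r) \<and>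
     wf_dtree ends V E l \<and> wf_dtree ends V E r)"

definition decomp_tree :: "('e \<Rightarrow> 'v set) \<Rightarrow> ('v, 'e) tgraph \<Rightarrow> ('v, 'e) tgraph dtree \<Rightarrow> bool" where
  "decomp_tree ends X T = (case X of (V, E, s, t) \<Rightarrow>
     connected_graph V E ends \<and> loopless E ends \<and> wf_dtree ends V E T \<and> lab T = X)"

definition maximal_dtree :: "('e \<Rightarrow> 'v set) \<Rightarrow> ('v, 'e) tgraph dtree \<Rightarrow> bool" where
  "maximal_dtree ends T \<longleftrightarrow> (\<forall>X\<in>leaves T. prime_tg ends X)"

end

theory Submission
  imports Defs
begin

text \<open>
  The partial polynomials of a series or parallel composition are those of the pieces combined, so
  that effective weights compose by \<open>ser_conn\<close> and \<open>par_conn\<close>, while the maximal number of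
  edge-disjoint paths between the terminals composes by minimum and sum. Hence the hypotheses on
  the sets S propagate upwards from single edges. That the leaves of a maximal tree are
  single edges rests on the fact that a series or parallel piece of a two-terminal
  series-parallel graph is again one.

  For the non-vanishing of Z, every series-parallel graph is glued at cut vertices from single edges
  and parallel compositions, and Z is multiplicative up to a power of q. In a parallel composition
  every proper constituent has a path between its terminals outside of itself, so its flow
  is at most L - 1 and its effective weight is controlled; conditions (3) and (4) then
  exclude the effective weight - q of the whole block, which is the only way for Z to vanish.
\<close>

section \<open>Reachability and components\<close>

text \<open>Following the construction of a series-parallel graph edge by edge does not prove that Z
  is non-zero: \<open>v e \<in> S 1\<close> is known for the edges of the final graph only, while an
  edge of an intermediate graph stands for a whole constituent, whose effective weight may lie in a
  larger set. The construction is therefore turned into a static decomposition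
  (\<open>glued\<close>) before any weight enters. Zeros and effective weights are linked by Z = q^2
  A + q B = q A (q + v_eff) for nonzero A. The two terminals of a whole parallel block are the one
  pair without a connection outside; there the flow can be L itself, split between the two sides as
  k + l = L, which is the shape of condition (4). For a given maximal tree the difficulty is that it
  need not be the derivation that shows the root to be series-parallel. Hence every admissible way
  of cutting such a graph has to be analysed, not only the cut made last in that derivation.\<close>

lemma adj_sym: "(x, y) \<in> adj F ends \<Longrightarrow> (y, x) \<in> adj F ends"
  by (auto simp: adj_def insert_commute)

lemma adjI: "e \<in> F \<Longrightarrow> ends e = {x, y} \<Longrightarrow> (x, y) \<in> adj F ends"
  by (auto simp: adj_def)

lemma adj_cong: "(\<And>e. e \<in> F \<Longrightarrow> ends e = ends' e) \<Longrightarrow> adj F ends = adj F ends'"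
  by (auto simp: adj_def)

lemma reach_cong: "(\<And>e. e \<in> F \<Longrightarrow> ends e = ends' e) \<Longrightarrow> reach F ends = reach F ends'"
  using adj_cong[of F ends ends'] by (simp add: reach_def fun_eq_iff)

lemma reach_refl [simp]: "reach F ends x x"
  by (simp add: reach_def)

lemma reach_sym: "reach F ends x y \<Longrightarrow> reach F ends y x"
  unfolding reach_def
  by (rule symD[OF sym_rtrancl]) (auto intro: symI adj_sym)

lemma reach_trans: "reach F ends x y \<Longrightarrow> reach F ends y z \<Longrightarrow> reach F ends x z"
  unfolding reach_def by (rule rtrancl_trans)

lemma reach_mono: "reach F ends x y \<Longrightarrow> F \<subseteq> F' \<Longrightarrow> reach F' ends x y"
  unfolding reach_def by (erule rtrancl_mono[THEN subsetD, rotated]) (auto simp: adj_def)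

lemma reach_edge: "e \<in> F \<Longrightarrow> ends e = {x, y} \<Longrightarrow> reach F ends x y"
  unfolding reach_def by (auto intro: adjI)

lemma reach_induct [consumes 1, case_names base step]:
  assumes "reach F ends x y" "P x"
    and "\<And>e z z'. e \<in> F \<Longrightarrow> ends e = {z, z'} \<Longrightarrow> P z \<Longrightarrow> P z'"
  shows "P y"
  using assms(1) unfolding reach_def
  by (induction rule: rtrancl_induct) (use assms(2,3) in \<open>auto simp: adj_def\<close>)

lemma reach_empty [simp]: "reach {} ends x y \<longleftrightarrow> x = y"
  by (auto simp: reach_def adj_def)

lemma reach_insert:
  assumes e: "ends e = {x, y}"
  shows "reach (insert e F) ends u w \<longleftrightarrow>
    reach F ends u w \<or> reach F ends u x \<and> reach F ends y w \<or> reach F ends u y \<and> reach F ends x w"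
    (is "_ \<longleftrightarrow> ?R w")
proof
  assume "reach (insert e F) ends u w"
  then show "?R w"
  proof (induction rule: reach_induct)
    case (step f z z')
    show ?case
    proof (cases "f = e")
      case True
      then have "z = x \<and> z' = y \<or> z = y \<and> z' = x"
        using step e by (auto simp: doubleton_eq_iff)
      then show ?thesis using step(3) by (auto intro: reach_trans)
    next
      case False
      then have "reach F ends z z'" using step by (auto intro: reach_edge)
      then show ?thesis using step(3) by (meson reach_trans)
    qed
  qed simp
next
  have "reach (insert e F) ends x y" "reach (insert e F) ends y x"
    using e by (auto intro: reach_edge simp: insert_commute)
  moreover have "reach F ends a b \<Longrightarrow> reach (insert e F) ends a b" for a b
    by (erule reach_mono) blast
  ultimately show "?R w \<Longrightarrow> reach (insert e F) ends u w"
    by (meson reach_trans)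
qed

text \<open>An excursion into F1 leaves and re-enters V2 at shared vertices, and F1 joins no two
  distinct ones, so it returns to where it started and can be deleted.\<close>

lemma reach_Un_separated:
  assumes r: "reach (F1 \<union> F2) ends x y"
    and F1: "\<And>e. e \<in> F1 \<Longrightarrow> ends e \<subseteq> V1" and F2: "\<And>e. e \<in> F2 \<Longrightarrow> ends e \<subseteq> V2"
    and sep: "\<And>u w. u \<in> V1 \<inter> V2 \<Longrightarrow> w \<in> V1 \<inter> V2 \<Longrightarrow> reach F1 ends u w \<Longrightarrow> u = w"
    and x: "x \<in> V2" and y: "y \<in> V2"
  shows "reach F2 ends x y"
proof -
  \<comment> \<open>While the walk is inside V1, the invariant remembers a shared vertex u at which
    the current excursion began.\<close>
  have "y \<in> V2 \<and> reach F2 ends x y \<or>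
      y \<in> V1 \<and> (\<exists>u\<in>V1 \<inter> V2. reach F2 ends x u \<and> reach F1 ends u y)" (is "?P y")
    using r
  proof (induction rule: reach_induct)
    case base
    then show ?case using x by simp
  next
    case (step e z z')
    show ?case
    proof (cases "e \<in> F2")
      case True
      then have z: "z \<in> V2" "z' \<in> V2" "reach F2 ends z z'"
        using F2[of e] step by (auto intro: reach_edge)
      have "reach F2 ends x z" using step(3) z sep by blast
      then show ?thesis using z by (meson reach_trans)
    next
      case False
      then have e: "e \<in> F1" using step by auto
      then have z: "z \<in> V1" "z' \<in> V1" "reach F1 ends z z'"
        using F1[of e] step by (auto intro: reach_edge)
      have "\<exists>u\<in>V1 \<inter> V2. reach F2 ends x u \<and> reach F1 ends u z"
        using step(3) z by auto
      then show ?thesis using z by (meson reach_trans)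
    qed
  qed
  then show ?thesis using y sep by blast
qed

lemma reach_Un_cutvertex:
  assumes F1: "\<And>e. e \<in> F1 \<Longrightarrow> ends e \<subseteq> V1" and F2: "\<And>e. e \<in> F2 \<Longrightarrow> ends e \<subseteq> V2"
    and c: "V1 \<inter> V2 = {c}" and x: "x \<in> V1" and y: "y \<in> V2"
  shows "reach (F1 \<union> F2) ends x y \<longleftrightarrow> reach F1 ends x c \<and> reach F2 ends c y"
proof
  assume "reach (F1 \<union> F2) ends x y"
  then have "y \<in> V1 \<and> reach F1 ends x y \<or> y \<in> V2 \<and> reach F1 ends x c \<and> reach F2 ends c y"
  proof (induction rule: reach_induct)
    case base
    then show ?case using x by simp
  next
    case (step e z z')
    show ?case
    proof (cases "e \<in> F2")
      case True
      then have z: "z \<in> V2" "z' \<in> V2" "reach F2 ends z z'"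
        using F2[of e] step by (auto intro: reach_edge)
      moreover have "z \<in> V1 \<Longrightarrow> z = c" using c \<open>z \<in> V2\<close> by blast
      ultimately have "reach F1 ends x c \<and> reach F2 ends c z" using step(3) by auto
      then show ?thesis using z by (meson reach_trans)
    next
      case False
      then have e: "e \<in> F1" using step by auto
      then have z: "z \<in> V1" "z' \<in> V1" "reach F1 ends z z'"
        using F1[of e] step by (auto intro: reach_edge)
      moreover have "z \<in> V2 \<Longrightarrow> z = c" using c \<open>z \<in> V1\<close> by blast
      ultimately have "reach F1 ends x z" using step(3) by auto
      then show ?thesis using z by (meson reach_trans)
    qed
  qed
  moreover have "y \<in> V1 \<Longrightarrow> y = c" using y c by blast
  ultimately show "reach F1 ends x c \<and> reach F2 ends c y" by auto
next
  assume "reach F1 ends x c \<and> reach F2 ends c y"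
  then show "reach (F1 \<union> F2) ends x y"
    by (meson reach_mono reach_trans Un_upper1 Un_upper2)
qed

text \<open>Seen from V2, all of F1 acts at most like one additional edge between s and t, so the
  three cases are those of \<open>reach_insert\<close>. On the V1 side it suffices to remember that
  s or t was reached inside F2.\<close>

lemma reach_Un_two:
  assumes r: "reach (F1 \<union> F2) ends x y"
    and F1: "\<And>e. e \<in> F1 \<Longrightarrow> ends e \<subseteq> V1" and F2: "\<And>e. e \<in> F2 \<Longrightarrow> ends e \<subseteq> V2"
    and st: "V1 \<inter> V2 = {s, t}" and x: "x \<in> V2" and y: "y \<in> V2"
  shows "reach F2 ends x y \<or> reach F2 ends x s \<and> reach F2 ends t y \<or>
    reach F2 ends x t \<and> reach F2 ends s y" (is "?Q y")
proof -
  have "y \<in> V2 \<and> ?Q y \<or> y \<in> V1 \<and> (reach F2 ends x s \<or> reach F2 ends x t)"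
    using r
  proof (induction rule: reach_induct)
    case base
    then show ?case using x by simp
  next
    case (step e z z')
    show ?case
    proof (cases "e \<in> F2")
      case True
      then have z: "z \<in> V2" "z' \<in> V2" "reach F2 ends z z'"
        using F2[of e] step by (auto intro: reach_edge)
      moreover have "z \<in> V1 \<Longrightarrow> z = s \<or> z = t" using st \<open>z \<in> V2\<close> by blast
      ultimately have "?Q z" using step(3) by auto
      then show ?thesis using z by (meson reach_trans)
    next
      case False
      then have e: "e \<in> F1" using step by auto
      then have z: "z \<in> V1" "z' \<in> V1"
        using F1[of e] step by auto
      moreover have "z \<in> V2 \<Longrightarrow> z = s \<or> z = t" using st \<open>z \<in> V1\<close> by blast
      ultimately have "reach F2 ends x s \<or> reach F2 ends x t" using step(3) by auto
      then show ?thesis using z by auto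
    qed
  qed
  moreover have "y \<in> V1 \<Longrightarrow> y = s \<or> y = t" using y st by blast
  ultimately show ?thesis by auto
qed

lemma reach_Un_par:
  assumes F1: "\<And>e. e \<in> F1 \<Longrightarrow> ends e \<subseteq> V1" and F2: "\<And>e. e \<in> F2 \<Longrightarrow> ends e \<subseteq> V2"
    and st: "V1 \<inter> V2 = {s, t}"
  shows "reach (F1 \<union> F2) ends s t \<longleftrightarrow> reach F1 ends s t \<or> reach F2 ends s t"
proof
  assume r: "reach (F1 \<union> F2) ends s t"
  have "reach F2 ends s t" if "\<not> reach F1 ends s t"
    by (rule reach_Un_separated[OF r F1 F2]) (use that st in \<open>auto dest: reach_sym\<close>)
  then show "reach F1 ends s t \<or> reach F2 ends s t" by blast
qed (meson reach_mono Un_upper1 Un_upper2)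

section \<open>Component counts when edges are added and graphs are glued\<close>

lemma ncomp_empty: "ncomp V {} ends = card V"
proof -
  have "(\<lambda>x. {y \<in> V. reach {} ends x y}) ` V = (\<lambda>x. {x}) ` V" by auto
  then show ?thesis by (simp add: ncomp_def card_image)
qed

lemma ncomp_insert_connected:
  assumes "ends e = {x, y}" "reach F ends x y"
  shows "ncomp V (insert e F) ends = ncomp V F ends"
proof -
  have "reach (insert e F) ends u w \<longleftrightarrow> reach F ends u w" for u w
    unfolding reach_insert[of ends e x y, OF assms(1)] using assms(2) by (metis reach_sym reach_trans)
  then show ?thesis by (simp add: ncomp_def)
qed

lemma ncomp_insert_disconnected:
  assumes fin: "finite V" and e: "ends e = {x, y}" and xy: "x \<in> V" "y \<in> V"
    and nr: "\<not> reach F ends x y"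
  shows "ncomp V F ends = Suc (ncomp V (insert e F) ends)"
proof -
  define C where "C = (\<lambda>z. {w \<in> V. reach F ends z w})"
  define D where "D = (\<lambda>z. {w \<in> V. reach (insert e F) ends z w})"
  \<comment> \<open>\<open>U\<close> consists of the vertices whose component does not meet e. Their
    classes survive unchanged, while those of x and y are replaced by their union.\<close>
  define U where "U = {z \<in> V. \<not> reach F ends x z \<and> \<not> reach F ends y z}"
  have CU: "C ` V = insert (C x) (insert (C y) (C ` U))"
  proof -
    have "C z = C w" if "reach F ends z w" for z w
      unfolding C_def using that by (metis reach_sym reach_trans)
    then show ?thesis using xy unfolding U_def by blast
  qed
  have DU: "D ` V = insert (C x \<union> C y) (C ` U)"
  proof -
    have 1: "D z = C z" if "z \<in> U" for z
      using that unfolding C_def D_def U_def reach_insert[of ends e x y, OF e] by (auto dest: reach_sym)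
    have 2: "D z = C x \<union> C y" if "reach F ends x z \<or> reach F ends y z" for z
    proof -
      have "reach (insert e F) ends z w \<longleftrightarrow> reach F ends x w \<or> reach F ends y w" for w
        unfolding reach_insert[of ends e x y, OF e] using that by (metis reach_trans reach_sym)
      then show ?thesis unfolding C_def D_def by blast
    qed
    have "D ` V = D ` (V - U) \<union> D ` U" unfolding U_def by blast
    also have "D ` U = C ` U" using 1 by auto
    also have "D ` (V - U) = {C x \<union> C y}"
    proof -
      have "x \<in> V - U" using xy by (auto simp: U_def)
      then show ?thesis using 2 by (auto simp: U_def)
    qed
    finally show ?thesis by simp
  qed
  have self: "z \<in> V \<Longrightarrow> z \<in> C z" for z unfolding C_def by simp
  have "C x \<noteq> C y" using self[OF xy(2)] nr unfolding C_def by blast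
  moreover have "C u \<noteq> C x" "C u \<noteq> C y" "C u \<noteq> C x \<union> C y" if "u \<in> U" for u
    using self[of u] that unfolding U_def C_def by blast+
  ultimately have n1: "C x \<notin> insert (C y) (C ` U)" "C y \<notin> C ` U"
    and n2: "C x \<union> C y \<notin> C ` U" by auto
  have fU: "finite (C ` U)" using fin unfolding U_def by simp
  have "card (C ` V) = Suc (card (D ` V))"
    unfolding CU DU using n1 n2 fU by simp
  then show ?thesis unfolding ncomp_def C_def D_def .
qed

lemma wf_graph_ends:
  assumes "wf_graph V E ends" "e \<in> E"
  obtains x y where "ends e = {x, y}" "x \<in> V" "y \<in> V"
proof -
  have "ends e \<subseteq> V" "card (ends e) = 1 \<or> card (ends e) = 2"
    using assms by (auto simp: wf_graph_def)
  then obtain x y where "ends e = {x, y}"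
    by (metis card_1_singletonE card_2_iff insert_absorb2)
  with \<open>ends e \<subseteq> V\<close> that show thesis by blast
qed

lemma ends_subset: "wf_graph V E ends \<Longrightarrow> F \<subseteq> E \<Longrightarrow> e \<in> F \<Longrightarrow> ends e \<subseteq> V"
  by (auto simp: wf_graph_def)

lemma wf_graph_mono: "wf_graph V E ends \<Longrightarrow> F \<subseteq> E \<Longrightarrow> wf_graph V F ends"
  by (auto simp: wf_graph_def intro: finite_subset)

text \<open>The edges of F2 are added one at a time. By the last hypothesis F1 never joins two
  vertices of V2 that are still apart in F, so the counts in V and in V2 drop at the same moments
  and their difference stays constant.\<close>

lemma ncomp_Un_aux:
  assumes wf: "wf_graph V2 F2 ends" and V: "finite V" "V2 \<subseteq> V"
    and eq: "\<And>F x y. F \<subseteq> F2 \<Longrightarrow> x \<in> V2 \<Longrightarrow> y \<in> V2 \<Longrightarrow> reach (F1 \<union> F) ends x y \<Longrightarrow> reach F ends x y"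
  shows "ncomp V (F1 \<union> F2) ends + card V2 = ncomp V F1 ends + ncomp V2 F2 ends"
proof -
  have "finite F2" using wf by (auto simp: wf_graph_def)
  moreover have "F2 \<subseteq> F2" by simp
  ultimately show ?thesis
  proof (induction rule: finite_subset_induct')
    case empty
    then show ?case by (simp add: ncomp_empty)
  next
    case (insert e F)
    obtain x y where e: "ends e = {x, y}" "x \<in> V2" "y \<in> V2"
      using wf_graph_ends[OF wf \<open>e \<in> F2\<close>] .
    have Un: "F1 \<union> insert e F = insert e (F1 \<union> F)" by simp
    have V2: "finite V2" using V finite_subset by blast
    show ?case
    proof (cases "reach F ends x y")
      case True
      then have "reach (F1 \<union> F) ends x y" by (rule reach_mono) simp
      then show ?thesis unfolding Un using True insert e by (simp add: ncomp_insert_connected)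
    next
      case False
      then have nr: "\<not> reach (F1 \<union> F) ends x y" using eq insert e by blast
      have "x \<in> V" "y \<in> V" using e V by auto
      then show ?thesis
        unfolding Un using insert.IH ncomp_insert_disconnected[OF V(1) e(1) _ _ nr]
          ncomp_insert_disconnected[OF V2 e False] by auto
    qed
  qed
qed

text \<open>The auxiliary lemma is used twice over the common vertex set, to add F2 to F1 and to add
  F1 to the empty set; what remains is inclusion-exclusion for the vertices.\<close>

lemma ncomp_Un_separated:
  assumes wf1: "wf_graph V1 F1 ends" and wf2: "wf_graph V2 F2 ends"
    and sep: "\<And>u w. u \<in> V1 \<inter> V2 \<Longrightarrow> w \<in> V1 \<inter> V2 \<Longrightarrow> reach F1 ends u w \<Longrightarrow> u = w"
  shows "ncomp (V1 \<union> V2) (F1 \<union> F2) ends + card (V1 \<inter> V2) = ncomp V1 F1 ends + ncomp V2 F2 ends"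
proof -
  have fin: "finite V1" "finite V2" using wf1 wf2 by (auto simp: wf_graph_def)
  have "ncomp (V1 \<union> V2) (F1 \<union> F2) ends + card V2 = ncomp (V1 \<union> V2) F1 ends + ncomp V2 F2 ends"
  proof (rule ncomp_Un_aux[OF wf2])
    fix F x y assume F: "F \<subseteq> F2" and xy: "x \<in> V2" "y \<in> V2" and r: "reach (F1 \<union> F) ends x y"
    show "reach F ends x y"
      by (rule reach_Un_separated[OF r ends_subset[OF wf1 order_refl] ends_subset[OF wf2 F] sep xy])
  qed (use fin in auto)
  moreover have "ncomp (V1 \<union> V2) ({} \<union> F1) ends + card V1 = ncomp (V1 \<union> V2) {} ends + ncomp V1 F1 ends"
    by (rule ncomp_Un_aux[OF wf1]) (use fin in auto)
  moreover have "card V1 + card V2 = card (V1 \<union> V2) + card (V1 \<inter> V2)"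
    using card_Un_Int[OF fin] .
  ultimately show ?thesis by (simp add: ncomp_empty)
qed

lemma ncomp_Un_par_connected:
  assumes wf1: "wf_graph V1 F1 ends" and wf2: "wf_graph V2 F2 ends"
    and st: "V1 \<inter> V2 = {s, t}" "s \<noteq> t"
    and r1: "reach F1 ends s t" and r2: "reach F2 ends s t"
  shows "ncomp (V1 \<union> V2) (F1 \<union> F2) ends + 1 = ncomp V1 F1 ends + ncomp V2 F2 ends"
proof -
  have "finite F2" using wf2 by (auto simp: wf_graph_def)
  moreover have "F2 \<subseteq> F2" by simp
  \<comment> \<open>The count has to be followed before F2 joins s and t as well, hence the
    correction term. The 2 is the number of shared vertices.\<close>
  ultimately have "ncomp (V1 \<union> V2) (F1 \<union> F2) ends + 2 =
      ncomp V1 F1 ends + ncomp V2 F2 ends + (if reach F2 ends s t then 1 else 0)"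
  proof (induction rule: finite_subset_induct')
    case empty
    have "ncomp (V2 \<union> V1) ({} \<union> F1) ends + card (V2 \<inter> V1) = ncomp V2 {} ends + ncomp V1 F1 ends"
      by (rule ncomp_Un_separated[OF _ wf1]) (use wf2 in \<open>auto simp: wf_graph_def\<close>)
    then show ?case using st by (simp add: Un_commute Int_commute)
  next
    case (insert e F)
    obtain x y where e: "ends e = {x, y}" "x \<in> V2" "y \<in> V2"
      using wf_graph_ends[OF wf2 \<open>e \<in> F2\<close>] .
    have Un: "F1 \<union> insert e F = insert e (F1 \<union> F)" by simp
    have fin: "finite V2" "finite (V1 \<union> V2)" using wf1 wf2 by (auto simp: wf_graph_def)
    have two: "reach (F1 \<union> F) ends x y \<Longrightarrow> reach F ends x y \<or> reach F ends x s \<and> reach F ends t y \<or>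
        reach F ends x t \<and> reach F ends s y"
      by (rule reach_Un_two[OF _ ends_subset[OF wf1 order_refl] ends_subset[OF wf2 insert(3)]])
        (use st e in auto)
    show ?case
    proof (cases "reach F ends x y")
      case True
      then have "reach (F1 \<union> F) ends x y" by (rule reach_mono) simp
      moreover have "reach (insert e F) ends s t = reach F ends s t"
        unfolding reach_insert[of ends e x y, OF e(1)] using True by (metis reach_sym reach_trans)
      ultimately show ?thesis
        unfolding Un using True insert e by (simp add: ncomp_insert_connected)
    next
      case False
      note F = False
      have n2: "ncomp V2 F ends = Suc (ncomp V2 (insert e F) ends)"
        using ncomp_insert_disconnected[OF fin(1) e F] .
      show ?thesis
      proof (cases "reach (F1 \<union> F) ends x y")
        \<comment> \<open>This is the edge that first joins s and t inside F2. Together with F1 it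
          closes a cycle, so the count of the union stays while that of V2 drops, and the correction
          term jumps to 1.\<close>
        case True
        have "\<not> reach F ends s t" "reach (insert e F) ends s t"
          unfolding reach_insert[of ends e x y, OF e(1)] using F two[OF True] by (metis reach_sym reach_trans)+
        then show ?thesis
          unfolding Un using n2 True e insert.IH by (simp add: ncomp_insert_connected)
      next
        case False
        have m: "reach F1 ends u w \<or> reach F ends u w \<Longrightarrow> reach (F1 \<union> F) ends u w" for u w
          by (meson reach_mono Un_upper1 Un_upper2)
        have "reach (insert e F) ends s t = reach F ends s t"
          unfolding reach_insert[of ends e x y, OF e(1)] using False m r1 by (metis reach_sym reach_trans)
        then show ?thesis
          unfolding Un using n2 insert.IH e
            ncomp_insert_disconnected[OF fin(2) e(1) _ _ False] by auto
      qed
    qed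
  qed
  then show ?thesis using r2 by simp
qed

section \<open>Partial partition functions\<close>

definition wt :: "'v set \<Rightarrow> ('e \<Rightarrow> 'v set) \<Rightarrow> complex \<Rightarrow> ('e \<Rightarrow> complex) \<Rightarrow> 'e set \<Rightarrow> complex" where
  "wt V ends q v F = q ^ ncomp V F ends * (\<Prod>e\<in>F. v e)"

lemma sum_Pow_Un:
  fixes f :: "'e set \<Rightarrow> complex"
  assumes "finite E1" "finite E2" "E1 \<inter> E2 = {}"
  shows "(\<Sum>F\<in>Pow (E1 \<union> E2). f F) = (\<Sum>F1\<in>Pow E1. \<Sum>F2\<in>Pow E2. f (F1 \<union> F2))"
proof -
  have "(\<Sum>F\<in>Pow (E1 \<union> E2). f F) = (\<Sum>(F1, F2)\<in>Pow E1 \<times> Pow E2. f (F1 \<union> F2))"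
    by (rule sum.reindex_bij_witness[of _ "\<lambda>(F1, F2). F1 \<union> F2" "\<lambda>F. (F \<inter> E1, F \<inter> E2)"])
      (use assms in \<open>auto simp: Int_Un_distrib[symmetric] inf.absorb1\<close>)
  then show ?thesis by (simp add: sum.cartesian_product)
qed

text \<open>Cleared denominators and an indicator in place of a restricted index set make the sum
  range over all of \<open>Pow E\<close>, so that products of such sums can be compared termwise
  with a sum over pairs of subsets.\<close>

lemma partA_alt:
  assumes "q \<noteq> 0" "finite E"
  shows "q\<^sup>2 * partA V E ends s t q v = (\<Sum>F\<in>Pow E. of_bool (\<not> reach F ends s t) * wt V ends q v F)"
proof -
  have "(\<Sum>F\<in>Pow E. of_bool (\<not> reach F ends s t) * wt V ends q v F) =
      (\<Sum>F\<in>{A. A \<subseteq> E \<and> \<not> reach A ends s t}. wt V ends q v F)"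
    by (rule sum.mono_neutral_cong_right) (use assms in auto)
  then show ?thesis using assms by (simp add: partA_def wt_def)
qed

lemma partB_alt:
  assumes "q \<noteq> 0" "finite E"
  shows "q * partB V E ends s t q v = (\<Sum>F\<in>Pow E. of_bool (reach F ends s t) * wt V ends q v F)"
proof -
  have "(\<Sum>F\<in>Pow E. of_bool (reach F ends s t) * wt V ends q v F) =
      (\<Sum>F\<in>{A. A \<subseteq> E \<and> reach A ends s t}. wt V ends q v F)"
    by (rule sum.mono_neutral_cong_right) (use assms in auto)
  then show ?thesis using assms by (simp add: partB_def wt_def)
qed

lemma tutte_partA_partB:
  assumes "q \<noteq> 0" "finite E"
  shows "tutte V E ends q v = q\<^sup>2 * partA V E ends s t q v + q * partB V E ends s t q v"
  unfolding partA_alt[OF assms] partB_alt[OF assms] sum.distrib[symmetric] tutte_def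
  by (rule sum.cong) (auto simp: wt_def)

section \<open>Partition functions of two graphs with disjoint edge sets\<close>

context
  fixes ends :: "'e \<Rightarrow> 'v set" and V1 V2 E1 E2
  assumes wf1: "wf_graph V1 E1 ends" and wf2: "wf_graph V2 E2 ends" and disj: "E1 \<inter> E2 = {}"
begin

lemma finite_edges: "finite E1" "finite E2" "finite (E1 \<union> E2)"
  using wf1 wf2 by (auto simp: wf_graph_def)

lemma wt_Un:
  assumes F: "F1 \<subseteq> E1" "F2 \<subseteq> E2"
    and n: "ncomp (V1 \<union> V2) (F1 \<union> F2) ends + k = ncomp V1 F1 ends + ncomp V2 F2 ends"
  shows "q ^ k * wt (V1 \<union> V2) ends q v (F1 \<union> F2) = wt V1 ends q v F1 * wt V2 ends q v F2"
proof -
  have "(\<Prod>e\<in>F1 \<union> F2. v e) = (\<Prod>e\<in>F1. v e) * (\<Prod>e\<in>F2. v e)"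
    by (rule prod.union_disjoint) (use F disj finite_edges in \<open>auto intro: finite_subset\<close>)
  then show ?thesis
    unfolding wt_def using arg_cong[OF n, of "\<lambda>n. q ^ n"] by (simp add: power_add mult_ac)
qed

text \<open>With at most one shared vertex the separation hypothesis is automatic. Disjoint unions
  (factor 1) and gluing at a cut vertex (factor q) are treated together.\<close>

lemma tutte_Un_separated:
  assumes "card (V1 \<inter> V2) \<le> 1"
  shows "q ^ card (V1 \<inter> V2) * tutte (V1 \<union> V2) (E1 \<union> E2) ends q v = tutte V1 E1 ends q v * tutte V2 E2 ends q v"
proof -
  have fin: "finite (V1 \<inter> V2)" using wf1 by (auto simp: wf_graph_def)
  have sep: "u = w" if "u \<in> V1 \<inter> V2" "w \<in> V1 \<inter> V2" for u w
    using assms fin that by (metis card_le_Suc0_iff_eq One_nat_def)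
  have "q ^ card (V1 \<inter> V2) * (\<Sum>F\<in>Pow (E1 \<union> E2). wt (V1 \<union> V2) ends q v F) =
      (\<Sum>F1\<in>Pow E1. \<Sum>F2\<in>Pow E2. wt V1 ends q v F1 * wt V2 ends q v F2)"
    unfolding sum_Pow_Un[OF finite_edges(1,2) disj] sum_distrib_left
    by (intro sum.cong refl wt_Un ncomp_Un_separated)
      (use sep in \<open>auto intro: wf_graph_mono[OF wf1] wf_graph_mono[OF wf2]\<close>)
  then show ?thesis
    by (simp add: tutte_def wt_def[symmetric] sum_product)
qed

text \<open>Gluing at c always costs one component, and the union connects s to t iff both pieces
  connect their terminals. The coefficient q of A1 A2 comes from the normalisation: A is divided by
  q^2 and B only by q.\<close>

lemma part_series:
  fixes v :: "'e \<Rightarrow> complex"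
  assumes q: "q \<noteq> 0" and c: "V1 \<inter> V2 = {c}" and st: "s \<in> V1" "t \<in> V2"
  defines "A1 \<equiv> partA V1 E1 ends s c q v" and "B1 \<equiv> partB V1 E1 ends s c q v"
    and "A2 \<equiv> partA V2 E2 ends c t q v" and "B2 \<equiv> partB V2 E2 ends c t q v"
  shows "partA (V1 \<union> V2) (E1 \<union> E2) ends s t q v = q * A1 * A2 + A1 * B2 + B1 * A2"
    and "partB (V1 \<union> V2) (E1 \<union> E2) ends s t q v = B1 * B2"
proof -
  let ?a1 = "\<lambda>F. of_bool (\<not> reach F ends s c) * wt V1 ends q v F"
  let ?b1 = "\<lambda>F. of_bool (reach F ends s c) * wt V1 ends q v F"
  let ?a2 = "\<lambda>F. of_bool (\<not> reach F ends c t) * wt V2 ends q v F"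
  let ?b2 = "\<lambda>F. of_bool (reach F ends c t) * wt V2 ends q v F"
  have w: "q * wt (V1 \<union> V2) ends q v (F1 \<union> F2) = wt V1 ends q v F1 * wt V2 ends q v F2"
    and r: "reach (F1 \<union> F2) ends s t \<longleftrightarrow> reach F1 ends s c \<and> reach F2 ends c t"
    if F: "F1 \<in> Pow E1" "F2 \<in> Pow E2" for F1 F2
  proof -
    have F': "F1 \<subseteq> E1" "F2 \<subseteq> E2" using F by auto
    show "reach (F1 \<union> F2) ends s t \<longleftrightarrow> reach F1 ends s c \<and> reach F2 ends c t"
      by (rule reach_Un_cutvertex[OF ends_subset[OF wf1 F'(1)] ends_subset[OF wf2 F'(2)] c st])
    have "ncomp (V1 \<union> V2) (F1 \<union> F2) ends + card (V1 \<inter> V2) = ncomp V1 F1 ends + ncomp V2 F2 ends"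
      by (rule ncomp_Un_separated[OF wf_graph_mono[OF wf1 F'(1)] wf_graph_mono[OF wf2 F'(2)]])
        (use c in auto)
    from wt_Un[OF F' this] c
    show "q * wt (V1 \<union> V2) ends q v (F1 \<union> F2) = wt V1 ends q v F1 * wt V2 ends q v F2" by simp
  qed
  have "q * (q\<^sup>2 * partA (V1 \<union> V2) (E1 \<union> E2) ends s t q v) =
      (\<Sum>F1\<in>Pow E1. \<Sum>F2\<in>Pow E2. ?a1 F1 * ?a2 F2 + ?a1 F1 * ?b2 F2 + ?b1 F1 * ?a2 F2)"
    unfolding partA_alt[OF q finite_edges(3)] sum_Pow_Un[OF finite_edges(1,2) disj] sum_distrib_left
    by (intro sum.cong refl) (auto simp: r w)
  also have "\<dots> = (q\<^sup>2 * A1) * (q\<^sup>2 * A2) + (q\<^sup>2 * A1) * (q * B2) + (q * B1) * (q\<^sup>2 * A2)"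
    unfolding A1_def A2_def B1_def B2_def partA_alt[OF q finite_edges(1)] partA_alt[OF q finite_edges(2)]
      partB_alt[OF q finite_edges(1)] partB_alt[OF q finite_edges(2)] sum_product sum.distrib ..
  finally have "q ^ 3 * partA (V1 \<union> V2) (E1 \<union> E2) ends s t q v = q ^ 3 * (q * A1 * A2 + A1 * B2 + B1 * A2)"
    by (simp add: algebra_simps power2_eq_square power3_eq_cube)
  then show "partA (V1 \<union> V2) (E1 \<union> E2) ends s t q v = q * A1 * A2 + A1 * B2 + B1 * A2"
    using q by simp
  have "q * (q * partB (V1 \<union> V2) (E1 \<union> E2) ends s t q v) =
      (\<Sum>F1\<in>Pow E1. \<Sum>F2\<in>Pow E2. ?b1 F1 * ?b2 F2)"
    unfolding partB_alt[OF q finite_edges(3)] sum_Pow_Un[OF finite_edges(1,2) disj] sum_distrib_left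
    by (intro sum.cong refl) (auto simp: r w)
  also have "\<dots> = (q * B1) * (q * B2)"
    unfolding B1_def B2_def partB_alt[OF q finite_edges(1)] partB_alt[OF q finite_edges(2)] sum_product ..
  finally show "partB (V1 \<union> V2) (E1 \<union> E2) ends s t q v = B1 * B2"
    using q by simp
qed

text \<open>Gluing at s and t costs two components, except when both pieces connect s to t, where it
  costs one. That exception yields an extra factor q, which the normalisation absorbs, so B1 B2
  appears with coefficient 1.\<close>

lemma part_parallel:
  fixes v :: "'e \<Rightarrow> complex"
  assumes q: "q \<noteq> 0" and st: "V1 \<inter> V2 = {s, t}" "s \<noteq> t"
  defines "A1 \<equiv> partA V1 E1 ends s t q v" and "B1 \<equiv> partB V1 E1 ends s t q v"
    and "A2 \<equiv> partA V2 E2 ends s t q v" and "B2 \<equiv> partB V2 E2 ends s t q v"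
  shows "partA (V1 \<union> V2) (E1 \<union> E2) ends s t q v = A1 * A2"
    and "partB (V1 \<union> V2) (E1 \<union> E2) ends s t q v = A1 * B2 + B1 * A2 + B1 * B2"
proof -
  let ?a1 = "\<lambda>F. of_bool (\<not> reach F ends s t) * wt V1 ends q v F"
  let ?b1 = "\<lambda>F. of_bool (reach F ends s t) * wt V1 ends q v F"
  let ?a2 = "\<lambda>F. of_bool (\<not> reach F ends s t) * wt V2 ends q v F"
  let ?b2 = "\<lambda>F. of_bool (reach F ends s t) * wt V2 ends q v F"
  have w: "q\<^sup>2 * wt (V1 \<union> V2) ends q v (F1 \<union> F2) =
        (if reach F1 ends s t \<and> reach F2 ends s t then q else 1) * (wt V1 ends q v F1 * wt V2 ends q v F2)"
    and r: "reach (F1 \<union> F2) ends s t \<longleftrightarrow> reach F1 ends s t \<or> reach F2 ends s t"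
    if F: "F1 \<in> Pow E1" "F2 \<in> Pow E2" for F1 F2
  proof -
    have F': "F1 \<subseteq> E1" "F2 \<subseteq> E2" using F by auto
    note wf = wf_graph_mono[OF wf1 F'(1)] wf_graph_mono[OF wf2 F'(2)]
    show "reach (F1 \<union> F2) ends s t \<longleftrightarrow> reach F1 ends s t \<or> reach F2 ends s t"
      by (rule reach_Un_par[OF ends_subset[OF wf1 F'(1)] ends_subset[OF wf2 F'(2)] st(1)])
    show "q\<^sup>2 * wt (V1 \<union> V2) ends q v (F1 \<union> F2) =
        (if reach F1 ends s t \<and> reach F2 ends s t then q else 1) * (wt V1 ends q v F1 * wt V2 ends q v F2)"
    proof (cases "reach F1 ends s t \<and> reach F2 ends s t")
      case True
      then have "q ^ 1 * wt (V1 \<union> V2) ends q v (F1 \<union> F2) = wt V1 ends q v F1 * wt V2 ends q v F2"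
        by (intro wt_Un F' ncomp_Un_par_connected[OF wf st]) auto
      then show ?thesis using True by (simp add: power2_eq_square)
    next
      case False
      then consider "\<not> reach F1 ends s t" | "\<not> reach F2 ends s t" by blast
      then have "ncomp (V1 \<union> V2) (F1 \<union> F2) ends + card (V1 \<inter> V2) = ncomp V1 F1 ends + ncomp V2 F2 ends"
      proof cases
        case 1
        then show ?thesis
          by (intro ncomp_Un_separated[OF wf]) (use st in \<open>auto dest: reach_sym\<close>)
      next
        case 2
        then have "ncomp (V2 \<union> V1) (F2 \<union> F1) ends + card (V2 \<inter> V1) = ncomp V2 F2 ends + ncomp V1 F1 ends"
          by (intro ncomp_Un_separated[OF wf(2) wf(1)])
            (use st in \<open>auto dest: reach_sym simp: Int_commute[of V2]\<close>)
        then show ?thesis by (simp add: Un_commute Int_commute)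
      qed
      then have "q ^ 2 * wt (V1 \<union> V2) ends q v (F1 \<union> F2) = wt V1 ends q v F1 * wt V2 ends q v F2"
        by (intro wt_Un F') (use st in simp)
      then show ?thesis using False by auto
    qed
  qed
  have "q\<^sup>2 * (q\<^sup>2 * partA (V1 \<union> V2) (E1 \<union> E2) ends s t q v) =
      (\<Sum>F1\<in>Pow E1. \<Sum>F2\<in>Pow E2. ?a1 F1 * ?a2 F2)"
    unfolding partA_alt[OF q finite_edges(3)] sum_Pow_Un[OF finite_edges(1,2) disj] sum_distrib_left
    by (intro sum.cong refl) (auto simp: r w)
  also have "\<dots> = (q\<^sup>2 * A1) * (q\<^sup>2 * A2)"
    unfolding A1_def A2_def partA_alt[OF q finite_edges(1)] partA_alt[OF q finite_edges(2)] sum_product ..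
  finally have "q\<^sup>2 * q\<^sup>2 * partA (V1 \<union> V2) (E1 \<union> E2) ends s t q v = q\<^sup>2 * q\<^sup>2 * (A1 * A2)"
    by (simp only: mult_ac)
  then show "partA (V1 \<union> V2) (E1 \<union> E2) ends s t q v = A1 * A2"
    using q by simp
  have "q\<^sup>2 * (q * partB (V1 \<union> V2) (E1 \<union> E2) ends s t q v) =
      (\<Sum>F1\<in>Pow E1. \<Sum>F2\<in>Pow E2. ?a1 F1 * ?b2 F2 + ?b1 F1 * ?a2 F2 + q * (?b1 F1 * ?b2 F2))"
    unfolding partB_alt[OF q finite_edges(3)] sum_Pow_Un[OF finite_edges(1,2) disj] sum_distrib_left
    by (intro sum.cong refl) (auto simp: r w)
  also have "\<dots> = (q\<^sup>2 * A1) * (q * B2) + (q * B1) * (q\<^sup>2 * A2) + q * ((q * B1) * (q * B2))"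
    unfolding A1_def A2_def B1_def B2_def partA_alt[OF q finite_edges(1)] partA_alt[OF q finite_edges(2)]
      partB_alt[OF q finite_edges(1)] partB_alt[OF q finite_edges(2)] sum_product sum.distrib
      sum_distrib_left[of q "\<lambda>F1. \<Sum>F2\<in>Pow E2. ?b1 F1 * ?b2 F2"]
      sum_distrib_left[of q "\<lambda>F2. ?b1 _ * ?b2 F2"] ..
  finally have "q ^ 3 * partB (V1 \<union> V2) (E1 \<union> E2) ends s t q v = q ^ 3 * (A1 * B2 + B1 * A2 + B1 * B2)"
    by (simp add: algebra_simps power2_eq_square power3_eq_cube)
  then show "partB (V1 \<union> V2) (E1 \<union> E2) ends s t q v = A1 * B2 + B1 * A2 + B1 * B2"
    using q by simp
qed

end

lemma part_edge:
  assumes "q \<noteq> 0" "s \<noteq> t" "ends e = {s, t}"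
  shows "partA {s, t} {e} ends s t q v = 1" and "partB {s, t} {e} ends s t q v = v e"
proof -
  have P: "Pow {e} = {{}, {e}}" by auto
  have r: "reach {e} ends s t" using assms by (auto intro: reach_edge)
  have n0: "ncomp {s, t} {} ends = 2" using assms by (simp add: ncomp_empty)
  then have n1: "ncomp {s, t} {e} ends = 1"
    using ncomp_insert_disconnected[of "{s, t}" ends e s t "{}"] assms by simp
  have "q\<^sup>2 * partA {s, t} {e} ends s t q v = q\<^sup>2" "q * partB {s, t} {e} ends s t q v = q * v e"
    using assms r n0 n1 by (simp_all add: partA_alt partB_alt P wt_def)
  then show "partA {s, t} {e} ends s t q v = 1" "partB {s, t} {e} ends s t q v = v e"
    using assms by simp_all
qed

section \<open>Edge-disjoint paths\<close>

text \<open>A system of paths is replaced by disjoint edge sets that each connect a to b. Simplicity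
  and order of the edges are dropped, so restricting to a piece and taking unions stay inside the
  notion.\<close>

definition disj_conns :: "'e set \<Rightarrow> ('e \<Rightarrow> 'v set) \<Rightarrow> 'v \<Rightarrow> 'v \<Rightarrow> nat \<Rightarrow> bool" where
  "disj_conns E ends a b k \<longleftrightarrow> (\<exists>F. (\<forall>i<k. F i \<subseteq> E \<and> reach (F i) ends a b) \<and>
     (\<forall>i<k. \<forall>j<k. i \<noteq> j \<longrightarrow> F i \<inter> F j = {}))"

lemma disj_connsE:
  assumes "disj_conns E ends a b k"
  obtains F where "\<And>i. i < k \<Longrightarrow> F i \<subseteq> E \<and> reach (F i) ends a b"
    "\<And>i j. i < k \<Longrightarrow> j < k \<Longrightarrow> i \<noteq> j \<Longrightarrow> F i \<inter> F j = {}"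
  using assms unfolding disj_conns_def by (elim exE conjE) metis

text \<open>An arbitrary finite index set is convenient when only some members of a family are kept,
  as in the parallel case.\<close>

lemma disj_connsI:
  assumes I: "finite I" "card I = k" and F: "\<And>i. i \<in> I \<Longrightarrow> F i \<subseteq> E" "\<And>i. i \<in> I \<Longrightarrow> reach (F i) ends a b"
    and d: "\<And>i j. i \<in> I \<Longrightarrow> j \<in> I \<Longrightarrow> i \<noteq> j \<Longrightarrow> F i \<inter> F j = {}"
  shows "disj_conns E ends a b k"
proof -
  obtain h where h: "bij_betw h {0..<k} I" using ex_bij_betw_nat_finite[OF I(1)] I(2) by auto
  have hi: "h i \<in> I" if "i < k" for i using h that by (auto simp: bij_betw_def)
  have "h i \<noteq> h j" if "i < k" "j < k" "i \<noteq> j" for i j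
    using h that by (auto simp: bij_betw_def inj_on_def)
  then show ?thesis unfolding disj_conns_def
    by (intro exI[of _ "F \<circ> h"]) (use hi F d in auto)
qed

lemma disj_conns_le:
  assumes "disj_conns E ends a b k" "l \<le> k"
  shows "disj_conns E ends a b l"
proof -
  obtain F where F: "\<And>i. i < k \<Longrightarrow> F i \<subseteq> E \<and> reach (F i) ends a b"
      "\<And>i j. i < k \<Longrightarrow> j < k \<Longrightarrow> i \<noteq> j \<Longrightarrow> F i \<inter> F j = {}"
    by (rule disj_connsE[OF assms(1)]) metis
  show ?thesis
  proof (rule disj_connsI[of "{..<l}" _ F])
    fix i j assume "i \<in> {..<l}" "j \<in> {..<l}" "i \<noteq> j"
    with assms(2) show "F i \<inter> F j = {}" by (intro F(2)) auto
  qed (use F(1) assms(2) in auto)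
qed

lemma disj_conns_mono:
  assumes "disj_conns E ends a b k" "E \<subseteq> E'"
  shows "disj_conns E' ends a b k"
proof -
  obtain F where F: "\<And>i. i < k \<Longrightarrow> F i \<subseteq> E \<and> reach (F i) ends a b"
      "\<And>i j. i < k \<Longrightarrow> j < k \<Longrightarrow> i \<noteq> j \<Longrightarrow> F i \<inter> F j = {}"
    by (rule disj_connsE[OF assms(1)]) metis
  show ?thesis
  proof (rule disj_connsI[of "{..<k}" _ F])
    fix i assume "i \<in> {..<k}"
    then show "F i \<subseteq> E'" "reach (F i) ends a b" using F(1)[of i] assms(2) by auto
  qed (use F(2) in auto)
qed

lemma disj_conns_1: "reach E ends a b \<Longrightarrow> disj_conns E ends a b 1"
  unfolding disj_conns_def by auto

lemma disj_conns_add: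
  assumes "disj_conns E1 ends a b k" "disj_conns E2 ends a b l" "E1 \<inter> E2 = {}"
  shows "disj_conns (E1 \<union> E2) ends a b (k + l)"
proof -
  obtain F where F: "\<And>i. i < k \<Longrightarrow> F i \<subseteq> E1 \<and> reach (F i) ends a b"
      "\<And>i j. i < k \<Longrightarrow> j < k \<Longrightarrow> i \<noteq> j \<Longrightarrow> F i \<inter> F j = {}"
    by (rule disj_connsE[OF assms(1)]) metis
  obtain H where H: "\<And>i. i < l \<Longrightarrow> H i \<subseteq> E2 \<and> reach (H i) ends a b"
      "\<And>i j. i < l \<Longrightarrow> j < l \<Longrightarrow> i \<noteq> j \<Longrightarrow> H i \<inter> H j = {}"
    by (rule disj_connsE[OF assms(2)]) metis
  have d: "F i \<inter> H j = {}" "H j \<inter> F i = {}" if "i < k" "j < l" for i j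
    using F(1)[OF that(1)] H(1)[OF that(2)] assms(3) by blast+
  show ?thesis unfolding disj_conns_def
  proof (intro exI[of _ "\<lambda>i. if i < k then F i else H (i - k)"] conjI allI impI)
    fix i assume "i < k + l"
    then show "(if i < k then F i else H (i - k)) \<subseteq> E1 \<union> E2"
      using F(1)[of i] H(1)[of "i - k"] by (cases "i < k") (auto simp: less_diff_conv2)
  next
    fix i assume "i < k + l"
    then show "reach (if i < k then F i else H (i - k)) ends a b"
      using F(1)[of i] H(1)[of "i - k"] by auto
  next
    fix i j assume "i < k + l" "j < k + l" "i \<noteq> j"
    then show "(if i < k then F i else H (i - k)) \<inter> (if j < k then F j else H (j - k)) = {}"
      using F(2)[of i j] H(2)[of "i - k" "j - k"] d[of i "j - k"] d[of j "i - k"]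
      by (auto simp del: Int_iff)
  qed
qed

text \<open>Since a and b differ, no connecting set is empty, and choosing an edge from each is
  injective. This makes the maximum that defines \<open>lambda\<close> one over a finite
  set.\<close>

lemma disj_conns_card:
  assumes "disj_conns E ends a b k" "finite E" "a \<noteq> b"
  shows "k \<le> card E"
proof -
  obtain F where F: "\<And>i. i < k \<Longrightarrow> F i \<subseteq> E \<and> reach (F i) ends a b"
      "\<And>i j. i < k \<Longrightarrow> j < k \<Longrightarrow> i \<noteq> j \<Longrightarrow> F i \<inter> F j = {}"
    by (rule disj_connsE[OF assms(1)]) metis
  have "F i \<noteq> {}" if "i < k" for i using F(1)[OF that] assms(3) by auto
  then have "\<forall>i<k. \<exists>e. e \<in> F i" by blast
  then obtain f where f: "\<And>i. i < k \<Longrightarrow> f i \<in> F i" by metis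
  have "inj_on f {..<k}"
    using f F(2) by (metis disjoint_iff inj_on_def lessThan_iff)
  moreover have "f ` {..<k} \<subseteq> E" using f F(1) by blast
  ultimately show ?thesis using card_inj_on_le[of f "{..<k}" E] assms(2) by simp
qed

section \<open>Paths versus connecting edge sets\<close>

lemma is_path_reach:
  assumes "is_path E ends a b vs es"
  shows "set es \<subseteq> E" "reach (set es) ends a b"
proof -
  have p: "vs \<noteq> []" "hd vs = a" "last vs = b" "length vs = Suc (length es)"
      "\<And>i. i < length es \<Longrightarrow> es ! i \<in> E" "\<And>i. i < length es \<Longrightarrow> ends (es ! i) = {vs ! i, vs ! Suc i}"
    using assms by (auto simp: is_path_def)
  show "set es \<subseteq> E" using p(5) by (auto simp: in_set_conv_nth)
  have "i \<le> length es \<Longrightarrow> reach (set es) ends (vs ! 0) (vs ! i)" for i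
  proof (induction i)
    case (Suc i)
    then have "reach (set es) ends (vs ! i) (vs ! Suc i)" using p(6)[of i] by (intro reach_edge[of "es ! i"]) auto
    with Suc show ?case by (auto intro: reach_trans)
  qed simp
  then have "reach (set es) ends (vs ! 0) (vs ! length es)" by blast
  then show "reach (set es) ends a b" using p by (simp add: hd_conv_nth last_conv_nth)
qed

lemma reach_is_path:
  assumes "reach E ends a b"
  shows "\<exists>vs es. is_path E ends a b vs es"
  using assms unfolding reach_def
proof (induction rule: converse_rtrancl_induct)
  case base
  show ?case by (intro exI[of _ "[b]"] exI[of _ "[]"]) (simp add: is_path_def)
next
  case (step x z)
  then obtain vs es where "is_path E ends z b vs es" by blast
  then have p: "vs \<noteq> []" "hd vs = z" "last vs = b" "distinct vs" "length vs = Suc (length es)"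
      "\<And>i. i < length es \<Longrightarrow> es ! i \<in> E \<and> ends (es ! i) = {vs ! i, vs ! Suc i}"
    by (auto simp: is_path_def)
  obtain e where e: "e \<in> E" "ends e = {x, z}" using step(1) by (auto simp: adj_def)
  show ?case
  proof (cases "x \<in> set vs")
    case True
    then obtain n where n: "n < length vs" "vs ! n = x" by (auto simp: in_set_conv_nth)
    \<comment> \<open>Prepending x would repeat a vertex, so the path is cut back to the part that
      starts at the occurrence of x.\<close>
    have "is_path E ends x b (drop n vs) (drop n es)"
      unfolding is_path_def using n p by (auto simp: hd_drop_conv_nth)
    then show ?thesis by blast
  next
    case False
    have "is_path E ends x b (x # vs) (e # es)"
      unfolding is_path_def using p e False by (auto simp: nth_Cons' hd_conv_nth gr0_conv_Suc)
    then show ?thesis by blast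
  qed
qed

lemma edge_disjoint_paths_iff: "edge_disjoint_paths E ends a b k \<longleftrightarrow> disj_conns E ends a b k"
proof
  assume "edge_disjoint_paths E ends a b k"
  then obtain P where P: "\<And>i. i < k \<Longrightarrow> is_path E ends a b (fst (P i)) (snd (P i))"
      "\<And>i j. i < k \<Longrightarrow> j < k \<Longrightarrow> i \<noteq> j \<Longrightarrow> set (snd (P i)) \<inter> set (snd (P j)) = {}"
    unfolding edge_disjoint_paths_def by (elim exE conjE) metis
  then show "disj_conns E ends a b k"
    unfolding disj_conns_def using is_path_reach[OF P(1)]
    by (intro exI[of _ "\<lambda>i. set (snd (P i))"]) auto
next
  assume "disj_conns E ends a b k"
  then obtain F where F: "\<And>i. i < k \<Longrightarrow> F i \<subseteq> E \<and> reach (F i) ends a b"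
      "\<And>i j. i < k \<Longrightarrow> j < k \<Longrightarrow> i \<noteq> j \<Longrightarrow> F i \<inter> F j = {}"
    by (rule disj_connsE) metis
  have "\<forall>i<k. \<exists>p. is_path (F i) ends a b (fst p) (snd p)"
    using F(1) reach_is_path[of _ ends a b] by fastforce
  then obtain P where P: "\<And>i. i < k \<Longrightarrow> is_path (F i) ends a b (fst (P i)) (snd (P i))" by metis
  have "is_path E ends a b (fst (P i)) (snd (P i))" if "i < k" for i
    using P[OF that] F(1)[OF that] by (auto simp: is_path_def)
  moreover have "set (snd (P i)) \<inter> set (snd (P j)) = {}" if "i < k" "j < k" "i \<noteq> j" for i j
    using F(2)[OF that] is_path_reach(1)[OF P[OF that(1)]] is_path_reach(1)[OF P[OF that(2)]] by blast
  ultimately show "edge_disjoint_paths E ends a b k"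
    unfolding edge_disjoint_paths_def by blast
qed

text \<open>Turns equations between flows into equivalences of existence statements. For a = b the
  empty edge set connects, so families of every size exist and the maximum would have no
  meaning.\<close>

lemma le_lambda_iff:
  assumes "finite E" "a \<noteq> b"
  shows "k \<le> lambda E ends a b \<longleftrightarrow> disj_conns E ends a b k"
proof -
  have "{k. disj_conns E ends a b k} \<subseteq> {..card E}"
    using disj_conns_card[OF _ assms] by blast
  then have fin: "finite {k. disj_conns E ends a b k}" by (rule finite_subset) simp
  have 0: "disj_conns E ends a b 0" by (simp add: disj_conns_def)
  have L: "lambda E ends a b = Max {k. disj_conns E ends a b k}"
    by (simp add: lambda_def edge_disjoint_paths_iff)
  then have "disj_conns E ends a b (lambda E ends a b)"
    using Max_in[OF fin] 0 by auto
  then show ?thesis using L Max_ge[OF fin, of k] disj_conns_le by auto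
qed

section \<open>Flow under inclusion, series and parallel composition\<close>

lemma lambda_mono:
  assumes "finite E'" "E \<subseteq> E'" "a \<noteq> b"
  shows "lambda E ends a b \<le> lambda E' ends a b"
proof -
  have "finite E" using assms finite_subset by blast
  then have "disj_conns E ends a b (lambda E ends a b)"
    using le_lambda_iff[of E a b] assms(3) by blast
  then show ?thesis
    unfolding le_lambda_iff[OF assms(1,3)] using assms(2) by (rule disj_conns_mono)
qed

lemma lambda_pos: "finite E \<Longrightarrow> a \<noteq> b \<Longrightarrow> reach E ends a b \<Longrightarrow> 1 \<le> lambda E ends a b"
  using le_lambda_iff disj_conns_1 by metis

lemma lambda_edge:
  assumes "s \<noteq> t" "ends e = {s, t}"
  shows "lambda {e} ends s t = 1"
proof -
  have "1 \<le> lambda {e} ends s t"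
    by (rule lambda_pos) (use assms in \<open>auto intro: reach_edge\<close>)
  moreover have "lambda {e} ends s t \<le> 1"
    using disj_conns_card[of "{e}" ends s t] le_lambda_iff[of "{e}" s t] assms by fastforce
  ultimately show ?thesis by simp
qed

lemma lambda_add_le:
  assumes fin: "finite E1" "finite E2" and "a \<noteq> b" "E1 \<inter> E2 = {}"
  shows "lambda E1 ends a b + lambda E2 ends a b \<le> lambda (E1 \<union> E2) ends a b"
  using assms disj_conns_add[of E1 ends a b _ E2] by (metis finite_UnI le_lambda_iff order_refl)

text \<open>Every connecting set restricts to one in each piece because it must pass c; conversely
  the i-th sets of two families of equal size are united. Thus the same numbers k are attained on
  both sides.\<close>

lemma lambda_series:
  assumes wf1: "wf_graph V1 E1 ends" and wf2: "wf_graph V2 E2 ends"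
    and c: "V1 \<inter> V2 = {c}" and disj: "E1 \<inter> E2 = {}" and st: "s \<in> V1" "t \<in> V2" "s \<noteq> c" "c \<noteq> t"
  shows "lambda (E1 \<union> E2) ends s t = min (lambda E1 ends s c) (lambda E2 ends c t)"
proof -
  have fin: "finite E1" "finite E2" "finite (E1 \<union> E2)"
    using wf1 wf2 by (auto simp: wf_graph_def)
  have "s \<noteq> t" using c st by blast
  have r: "reach F ends s t \<longleftrightarrow> reach (F \<inter> E1) ends s c \<and> reach (F \<inter> E2) ends c t"
    if "F \<subseteq> E1 \<union> E2" for F
  proof -
    have "reach ((F \<inter> E1) \<union> (F \<inter> E2)) ends s t \<longleftrightarrow> reach (F \<inter> E1) ends s c \<and> reach (F \<inter> E2) ends c t"
      by (rule reach_Un_cutvertex[OF ends_subset[OF wf1] ends_subset[OF wf2] c st(1,2)]) auto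
    then show ?thesis using that by (simp add: Int_Un_distrib[symmetric] inf.absorb1)
  qed
  have "disj_conns (E1 \<union> E2) ends s t k \<longleftrightarrow> disj_conns E1 ends s c k \<and> disj_conns E2 ends c t k" for k
  proof
    assume "disj_conns (E1 \<union> E2) ends s t k"
    then obtain F where F: "\<And>i. i < k \<Longrightarrow> F i \<subseteq> E1 \<union> E2 \<and> reach (F i) ends s t"
        "\<And>i j. i < k \<Longrightarrow> j < k \<Longrightarrow> i \<noteq> j \<Longrightarrow> F i \<inter> F j = {}"
      by (rule disj_connsE) metis
    show "disj_conns E1 ends s c k \<and> disj_conns E2 ends c t k"
    proof
      show "disj_conns E1 ends s c k"
        unfolding disj_conns_def
        by (intro exI[of _ "\<lambda>i. F i \<inter> E1"]) (use F r in fastforce)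
      show "disj_conns E2 ends c t k"
        unfolding disj_conns_def
        by (intro exI[of _ "\<lambda>i. F i \<inter> E2"]) (use F r in fastforce)
    qed
  next
    assume "disj_conns E1 ends s c k \<and> disj_conns E2 ends c t k"
    then have *: "disj_conns E1 ends s c k" "disj_conns E2 ends c t k" by auto
    obtain F where F: "\<And>i. i < k \<Longrightarrow> F i \<subseteq> E1 \<and> reach (F i) ends s c"
        "\<And>i j. i < k \<Longrightarrow> j < k \<Longrightarrow> i \<noteq> j \<Longrightarrow> F i \<inter> F j = {}"
      by (rule disj_connsE[OF *(1)]) metis
    obtain H where H: "\<And>i. i < k \<Longrightarrow> H i \<subseteq> E2 \<and> reach (H i) ends c t"
        "\<And>i j. i < k \<Longrightarrow> j < k \<Longrightarrow> i \<noteq> j \<Longrightarrow> H i \<inter> H j = {}"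
      by (rule disj_connsE[OF *(2)]) metis
    show "disj_conns (E1 \<union> E2) ends s t k"
      unfolding disj_conns_def
    proof (intro exI[of _ "\<lambda>i. F i \<union> H i"] conjI allI impI)
      fix i assume "i < k"
      then show "F i \<union> H i \<subseteq> E1 \<union> E2" "reach (F i \<union> H i) ends s t"
        using F(1) H(1) by (blast, meson reach_mono reach_trans Un_upper1 Un_upper2)
    next
      fix i j assume "i < k" "j < k" "i \<noteq> j"
      then show "(F i \<union> H i) \<inter> (F j \<union> H j) = {}"
        using F(1)[of i] H(1)[of i] F(1)[of j] H(1)[of j] F(2)[of i j] H(2)[of i j] disj by blast
    qed
  qed
  then have "k \<le> lambda (E1 \<union> E2) ends s t \<longleftrightarrow> k \<le> min (lambda E1 ends s c) (lambda E2 ends c t)" for k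
    using fin st \<open>s \<noteq> t\<close> by (simp add: le_lambda_iff)
  then show ?thesis by (meson order_antisym order_refl)
qed

text \<open>A connecting set of the union already connects s to t within one of the pieces. The
  indices are therefore covered by \<open>I1\<close> and \<open>I2\<close>, and a possible overlap
  does no harm to the upper bound.\<close>

lemma lambda_parallel:
  assumes wf1: "wf_graph V1 E1 ends" and wf2: "wf_graph V2 E2 ends"
    and V: "V1 \<inter> V2 = {s, t}" and disj: "E1 \<inter> E2 = {}" and st: "s \<noteq> t"
  shows "lambda (E1 \<union> E2) ends s t = lambda E1 ends s t + lambda E2 ends s t"
proof (rule antisym)
  have fin: "finite E1" "finite E2" "finite (E1 \<union> E2)"
    using wf1 wf2 by (auto simp: wf_graph_def)
  show "lambda E1 ends s t + lambda E2 ends s t \<le> lambda (E1 \<union> E2) ends s t"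
    by (rule lambda_add_le) (use fin st disj in auto)
  let ?k = "lambda (E1 \<union> E2) ends s t"
  have "disj_conns (E1 \<union> E2) ends s t ?k" using le_lambda_iff[OF fin(3) st] by blast
  then obtain F where F: "\<And>i. i < ?k \<Longrightarrow> F i \<subseteq> E1 \<union> E2 \<and> reach (F i) ends s t"
      "\<And>i j. i < ?k \<Longrightarrow> j < ?k \<Longrightarrow> i \<noteq> j \<Longrightarrow> F i \<inter> F j = {}"
    by (rule disj_connsE) metis
  define I1 where "I1 = {i. i < ?k \<and> reach (F i \<inter> E1) ends s t}"
  define I2 where "I2 = {i. i < ?k \<and> reach (F i \<inter> E2) ends s t}"
  have "i \<in> I1 \<union> I2" if "i < ?k" for i
  proof -
    have "reach ((F i \<inter> E1) \<union> (F i \<inter> E2)) ends s t \<longleftrightarrow>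
        reach (F i \<inter> E1) ends s t \<or> reach (F i \<inter> E2) ends s t"
      by (rule reach_Un_par[OF ends_subset[OF wf1] ends_subset[OF wf2] V]) auto
    moreover have "(F i \<inter> E1) \<union> (F i \<inter> E2) = F i" using F(1)[OF that] by blast
    ultimately show ?thesis using F(1)[OF that] that by (simp add: I1_def I2_def)
  qed
  then have "{..<?k} \<subseteq> I1 \<union> I2" by auto
  moreover have finI: "finite I1" "finite I2" by (simp_all add: I1_def I2_def)
  ultimately have "?k \<le> card I1 + card I2"
    by (metis card_Un_le card_lessThan card_mono finite_UnI order_trans)
  moreover have "disj_conns E1 ends s t (card I1)"
    by (rule disj_connsI[OF finI(1) refl, of "\<lambda>i. F i \<inter> E1"]) (use F(2) in \<open>auto simp: I1_def\<close>)
  moreover have "disj_conns E2 ends s t (card I2)"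
    by (rule disj_connsI[OF finI(2) refl, of "\<lambda>i. F i \<inter> E2"]) (use F(2) in \<open>auto simp: I2_def\<close>)
  ultimately show "?k \<le> lambda E1 ends s t + lambda E2 ends s t"
    using le_lambda_iff[OF fin(1) st] le_lambda_iff[OF fin(2) st] by (meson add_mono order_trans)
qed

section \<open>Two-terminal series-parallel graphs\<close>

lemma tsp_serI:
  "tsp ends (V1, E1, s, c) \<Longrightarrow> tsp ends (V2, E2, c, t) \<Longrightarrow> V1 \<inter> V2 = {c} \<Longrightarrow> E1 \<inter> E2 = {} \<Longrightarrow>
    tsp ends (V1 \<union> V2, E1 \<union> E2, s, t)"
  by (rule tsp_ser[of ends "(V1, E1, s, c)" "(V2, E2, c, t)"]) (simp_all add: is_ser_def)

lemma tsp_parI: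
  "tsp ends (V1, E1, s, t) \<Longrightarrow> tsp ends (V2, E2, s, t) \<Longrightarrow> V1 \<inter> V2 = {s, t} \<Longrightarrow> E1 \<inter> E2 = {} \<Longrightarrow>
    tsp ends (V1 \<union> V2, E1 \<union> E2, s, t)"
  by (rule tsp_par[of ends "(V1, E1, s, t)" "(V2, E2, s, t)"]) (simp_all add: is_par_def)

lemma tsp_tuple_induct [consumes 1, case_names K2 ser par]:
  assumes "tsp ends (V, E, s, t)"
    and K2: "\<And>s t e. s \<noteq> t \<Longrightarrow> ends e = {s, t} \<Longrightarrow> P {s, t} {e} s t"
    and ser: "\<And>V1 E1 V2 E2 s c t. tsp ends (V1, E1, s, c) \<Longrightarrow> tsp ends (V2, E2, c, t) \<Longrightarrow>
      V1 \<inter> V2 = {c} \<Longrightarrow> E1 \<inter> E2 = {} \<Longrightarrow> P V1 E1 s c \<Longrightarrow> P V2 E2 c t \<Longrightarrow>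
      P (V1 \<union> V2) (E1 \<union> E2) s t"
    and par: "\<And>V1 E1 V2 E2 s t. tsp ends (V1, E1, s, t) \<Longrightarrow> tsp ends (V2, E2, s, t) \<Longrightarrow>
      V1 \<inter> V2 = {s, t} \<Longrightarrow> E1 \<inter> E2 = {} \<Longrightarrow> P V1 E1 s t \<Longrightarrow> P V2 E2 s t \<Longrightarrow>
      P (V1 \<union> V2) (E1 \<union> E2) s t"
  shows "P V E s t"
proof -
  have "case X of (V, E, s, t) \<Rightarrow> P V E s t" if "tsp ends X" for X
    using that
  proof (induction rule: tsp.induct)
    case (tsp_K2 s t e)
    then show ?case using K2 by simp
  next
    case (tsp_ser X1 X2 X)
    then show ?case using ser
      by (cases X; cases X1; cases X2) (simp add: is_ser_def)
  next
    case (tsp_par X1 X2 X)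
    then show ?case using par
      by (cases X; cases X1; cases X2) (simp add: is_par_def)
  qed
  from this[OF assms(1)] show ?thesis by simp
qed

text \<open>The covering clause excludes isolated vertices; through it the splitting lemmas can
  describe a piece by its edge set alone.\<close>

lemma tsp_basic:
  assumes "tsp ends (V, E, s, t)"
  shows "s \<noteq> t \<and> s \<in> V \<and> t \<in> V \<and> wf_graph V E ends \<and> loopless E ends \<and>
    \<Union> (ends ` E) = V \<and> reach E ends s t"
  using assms
proof (induction rule: tsp_tuple_induct)
  case (K2 s t e)
  then show ?case by (auto simp: wf_graph_def loopless_def intro: reach_edge)
next
  case (ser V1 E1 V2 E2 s c t)
  have "s \<noteq> t" using ser by blast
  moreover have "reach (E1 \<union> E2) ends s t"
    using ser by (meson reach_mono reach_trans Un_upper1 Un_upper2)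
  ultimately show ?case using ser by (auto simp: wf_graph_def loopless_def)
next
  case (par V1 E1 V2 E2 s t)
  have "reach (E1 \<union> E2) ends s t" using par by (meson reach_mono Un_upper1)
  then show ?case using par by (auto simp: wf_graph_def loopless_def)
qed

lemma tsp_ends: "tsp ends (V, E, s, t) \<Longrightarrow> e \<in> E \<Longrightarrow> ends e \<subseteq> V"
  using tsp_basic by (metis ends_subset order_refl)

lemma tsp_nonempty: "tsp ends (V, E, s, t) \<Longrightarrow> E \<noteq> {}"
  using tsp_basic by fastforce

lemma tsp_two_terminal: "tsp ends X \<Longrightarrow> two_terminal ends X"
  by (cases X) (use tsp_basic in \<open>force simp: two_terminal_def\<close>)

lemma tsp_other_end:
  assumes "tsp ends (V, E, s, t)" "e \<in> E"
  obtains u where "u \<in> ends e" "u \<noteq> z" "u \<in> V"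
proof -
  have "ends e \<subseteq> V" "card (ends e) = 2"
    using tsp_basic[OF assms(1)] assms(2) by (auto simp: wf_graph_def loopless_def)
  then show thesis using that by (metis card_2_iff' subsetD)
qed

text \<open>Part of the fact that adding an edge between s and t makes the graph 2-connected.\<close>

lemma tsp_avoid:
  assumes "tsp ends (V, E, s, t)"
  shows "(\<forall>x\<in>V - {s}. reach {e \<in> E. s \<notin> ends e} ends x t) \<and>
    (\<forall>x\<in>V - {t}. reach {e \<in> E. t \<notin> ends e} ends x s)"
  using assms
proof (induction rule: tsp_tuple_induct)
  case (K2 s t e)
  then show ?case by auto
next
  case (ser V1 E1 V2 E2 s c t)
  note b1 = tsp_basic[OF ser(1)] and b2 = tsp_basic[OF ser(2)]
  have "s \<in> V1" "s \<noteq> c" "t \<in> V2" "c \<noteq> t" using b1 b2 by simp_all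
  then have st: "s \<notin> V2" "t \<notin> V1" using ser(3) by (metis IntI singletonD)+
  then have "\<And>e. e \<in> E2 \<Longrightarrow> s \<notin> ends e" "\<And>e. e \<in> E1 \<Longrightarrow> t \<notin> ends e"
    using tsp_ends[OF ser(1)] tsp_ends[OF ser(2)] by blast+
  then have sub: "{e \<in> E1. s \<notin> ends e} \<subseteq> {e \<in> E1 \<union> E2. s \<notin> ends e}" "E2 \<subseteq> {e \<in> E1 \<union> E2. s \<notin> ends e}"
    "{e \<in> E2. t \<notin> ends e} \<subseteq> {e \<in> E1 \<union> E2. t \<notin> ends e}" "E1 \<subseteq> {e \<in> E1 \<union> E2. t \<notin> ends e}"
    by auto
  have r: "reach E2 ends c t" "reach E1 ends c s" using b1 b2 by (auto intro: reach_sym)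
  show ?case
  proof (intro conjI ballI)
    fix x assume x: "x \<in> V1 \<union> V2 - {s}"
    show "reach {e \<in> E1 \<union> E2. s \<notin> ends e} ends x t"
    proof (cases "x \<in> V1")
      case True
      then have "reach {e \<in> E1. s \<notin> ends e} ends x c" using ser x by blast
      then show ?thesis using r(1) sub(1,2) by (meson reach_mono reach_trans)
    next
      case False
      then have "x \<in> V2 - {c}" using x b1 by blast
      then have "reach {e \<in> E2. c \<notin> ends e} ends x t" using ser by blast
      then show ?thesis using sub(2) by (elim reach_mono) auto
    qed
  next
    fix x assume x: "x \<in> V1 \<union> V2 - {t}"
    show "reach {e \<in> E1 \<union> E2. t \<notin> ends e} ends x s"
    proof (cases "x \<in> V2")
      case True
      then have "reach {e \<in> E2. t \<notin> ends e} ends x c" using ser x by blast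
      then show ?thesis using r(2) sub(3,4) by (meson reach_mono reach_trans)
    next
      case False
      then have "x \<in> V1 - {c}" using x b2 by blast
      then have "reach {e \<in> E1. c \<notin> ends e} ends x s" using ser by blast
      then show ?thesis using sub(4) by (elim reach_mono) auto
    qed
  qed
next
  case (par V1 E1 V2 E2 s t)
  have "reach {e \<in> E1 \<union> E2. u \<notin> ends e} ends x w"
    if "reach {e \<in> E1. u \<notin> ends e} ends x w \<or> reach {e \<in> E2. u \<notin> ends e} ends x w" for u x w
    using that by (elim disjE reach_mono) auto
  then show ?case using par by blast
qed

lemma tsp_reverse: "tsp ends (V, E, s, t) \<Longrightarrow> tsp ends (V, E, t, s)"
proof (induction rule: tsp_tuple_induct)
  case (K2 s t e)
  then show ?case using tsp_K2[of t s ends e] by (simp add: insert_commute)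
next
  case (ser V1 E1 V2 E2 s c t)
  then show ?case using tsp_serI[of ends V2 E2 t c V1 E1 s] by (simp add: Un_commute Int_commute)
next
  case (par V1 E1 V2 E2 s t)
  then show ?case using tsp_parI[of ends V1 E1 t s V2 E2] by (simp add: insert_commute)
qed

lemma tsp_cong:
  assumes "tsp ends (V, E, s, t)" "\<And>e. e \<in> E \<Longrightarrow> ends e = ends' e"
  shows "tsp ends' (V, E, s, t)"
  using assms
proof (induction rule: tsp_tuple_induct)
  case (K2 s t e)
  then show ?case using tsp_K2[of s t ends' e] by simp
next
  case (ser V1 E1 V2 E2 s c t)
  then show ?case by (intro tsp_serI[of ends' V1 E1 s c]) auto
next
  case (par V1 E1 V2 E2 s t)
  then show ?case by (intro tsp_parI[of ends' V1 E1 s t]) auto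
qed

section \<open>Splitting a two-terminal series-parallel graph\<close>

text \<open>Edges of W and of W' meet only in Z, so a walk that avoids Z cannot change from one
  class to the other.\<close>

lemma split_closed:
  assumes "reach F ends x y" "F \<subseteq> W \<union> W'" "\<Union> (ends ` W) \<inter> \<Union> (ends ` W') \<subseteq> Z"
    and "\<And>e. e \<in> F \<Longrightarrow> ends e \<inter> Z = {}" "x \<in> \<Union> (ends ` W)"
  shows "y \<in> \<Union> (ends ` W)"
  using assms(1)
proof (induction rule: reach_induct)
  case (step e z z')
  have "z \<notin> Z" using assms(4)[OF step(1)] step(2) by auto
  then have "z \<notin> \<Union> (ends ` W')" using step(3) assms(3) by blast
  then have "e \<in> W" using step(1,2) assms(2) by auto
  then show ?case using step(2) by auto
qed (rule assms(5))

text \<open>A series composition cannot be separated at its own terminals: from every edge the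
  middle vertex is reachable without using them, so it would lie on both sides. In a parallel
  composition W is cut along the two halves and the parts are recomposed.\<close>

lemma tsp_split_par:
  assumes "tsp ends (V, E, s, t)" "W \<subseteq> E" "W \<noteq> {}"
    and "\<Union> (ends ` W) \<inter> \<Union> (ends ` (E - W)) \<subseteq> {s, t}"
  shows "tsp ends (\<Union> (ends ` W), W, s, t)"
  using assms
proof (induction arbitrary: W rule: tsp_tuple_induct)
  case (K2 s t e)
  then have "W = {e}" by auto
  then show ?case using K2 tsp_K2[of s t ends e] by simp
next
  case (ser V1 E1 V2 E2 s c t)
  note b1 = tsp_basic[OF ser(1)] and b2 = tsp_basic[OF ser(2)]
  have "s \<in> V1" "s \<noteq> c" "t \<in> V2" "c \<noteq> t" using b1 b2 by simp_all
  then have st: "s \<notin> V2" "t \<notin> V1" using ser(3) by (metis IntI singletonD)+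
  then have av: "\<And>e. e \<in> E2 \<Longrightarrow> s \<notin> ends e" "\<And>e. e \<in> E1 \<Longrightarrow> t \<notin> ends e"
    using tsp_ends[OF ser(1)] tsp_ends[OF ser(2)] by blast+
  \<comment> \<open>Stated for an arbitrary splitting so that it applies to W and to its complement
    alike.\<close>
  have c: "c \<in> \<Union> (ends ` X)"
    if X: "X \<union> X' = E1 \<union> E2" "\<Union> (ends ` X) \<inter> \<Union> (ends ` X') \<subseteq> {s, t}" "e \<in> X" for X X' e
  proof -
    consider "e \<in> E1" | "e \<in> E2" using X by blast
    then show ?thesis
    proof cases
      case 1
      obtain u where u: "u \<in> ends e" "u \<noteq> s" "u \<in> V1" using tsp_other_end[OF ser(1) 1] .
      then have "reach {e \<in> E1. s \<notin> ends e} ends u c" using tsp_avoid[OF ser(1)] by blast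
      then show ?thesis
        by (rule split_closed[of _ _ _ _ X X' "{s, t}"]) (use X u av in auto)
    next
      case 2
      obtain u where u: "u \<in> ends e" "u \<noteq> t" "u \<in> V2" using tsp_other_end[OF ser(2) 2] .
      then have "reach {e \<in> E2. t \<notin> ends e} ends u c" using tsp_avoid[OF ser(2)] by blast
      then show ?thesis
        by (rule split_closed[of _ _ _ _ X X' "{s, t}"]) (use X u av in auto)
    qed
  qed
  have "W = E1 \<union> E2"
  proof (rule ccontr)
    assume "W \<noteq> E1 \<union> E2"
    then obtain e e' where e: "e \<in> W" "e' \<in> E1 \<union> E2 - W" using ser(7,8) by blast
    have "c \<in> \<Union> (ends ` W)"
      by (rule c[of _ "E1 \<union> E2 - W" e]) (use ser(7,9) e in auto)
    moreover have "c \<in> \<Union> (ends ` (E1 \<union> E2 - W))"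
      by (rule c[of _ W e']) (use ser(7,9) e in auto)
    ultimately have "c \<in> {s, t}" using ser(9) by (meson IntI subsetD)
    then show False using b1 b2 by simp
  qed
  moreover have "\<Union> (ends ` (E1 \<union> E2)) = V1 \<union> V2" using b1 b2 by blast
  ultimately show ?case using tsp_serI[OF ser(1-4)] by simp
next
  case (par V1 E1 V2 E2 s t)
  note b1 = tsp_basic[OF par(1)] and b2 = tsp_basic[OF par(2)]
  have W: "W = W \<inter> E1 \<union> W \<inter> E2" using par by blast
  have 1: "tsp ends (\<Union> (ends ` (W \<inter> E1)), W \<inter> E1, s, t)" if "W \<inter> E1 \<noteq> {}"
    by (rule par(5)) (use that par(9) in auto)
  have 2: "tsp ends (\<Union> (ends ` (W \<inter> E2)), W \<inter> E2, s, t)" if "W \<inter> E2 \<noteq> {}"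
    by (rule par(6)) (use that par(9) in auto)
  show ?case
  proof (cases "W \<inter> E1 = {} \<or> W \<inter> E2 = {}")
    case True
    then consider "W = W \<inter> E1" "W \<inter> E1 \<noteq> {}" | "W = W \<inter> E2" "W \<inter> E2 \<noteq> {}"
      using par(8) W by auto
    then show ?thesis using 1 2 by cases simp_all
  next
    case False
    have "tsp ends (\<Union> (ends ` (W \<inter> E1)) \<union> \<Union> (ends ` (W \<inter> E2)), W \<inter> E1 \<union> W \<inter> E2, s, t)"
    proof (rule tsp_parI)
      show "tsp ends (\<Union> (ends ` (W \<inter> E1)), W \<inter> E1, s, t)" "tsp ends (\<Union> (ends ` (W \<inter> E2)), W \<inter> E2, s, t)"
        using 1 2 False by auto
      then have "{s, t} \<subseteq> \<Union> (ends ` (W \<inter> E1)) \<inter> \<Union> (ends ` (W \<inter> E2))"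
        using tsp_basic by (metis Int_iff empty_subsetI insert_subset)
      moreover have "\<Union> (ends ` (W \<inter> E1)) \<subseteq> V1" "\<Union> (ends ` (W \<inter> E2)) \<subseteq> V2"
        using tsp_ends[OF par(1)] tsp_ends[OF par(2)] by blast+
      ultimately show "\<Union> (ends ` (W \<inter> E1)) \<inter> \<Union> (ends ` (W \<inter> E2)) = {s, t}" using par(3) by blast
    qed (use par in auto)
    then show ?thesis using W by (metis Union_Un_distrib image_Un)
  qed
qed

text \<open>A parallel composition has no cut vertex between its terminals, since one of its halves
  joins them without c. In a series composition with middle vertex d, either c = d and the two cuts
  agree, or c lies inside one half; then the other half belongs entirely to one side, and the half
  containing c is split by induction and reassembled at d.\<close>

lemma tsp_split_ser:
  assumes "tsp ends (V, E, s, t)" "W \<union> W' = E" "W \<inter> W' = {}"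
    and "\<Union> (ends ` W) \<inter> \<Union> (ends ` W') = {c}" "c \<noteq> s" "c \<noteq> t"
    and "s \<in> \<Union> (ends ` W)" "t \<in> \<Union> (ends ` W')"
  shows "tsp ends (\<Union> (ends ` W), W, s, c) \<and> tsp ends (\<Union> (ends ` W'), W', c, t)"
  using assms
proof (induction arbitrary: W W' rule: tsp_tuple_induct)
  case (K2 s t e)
  then have "e \<in> W" "e \<in> W'" by blast+
  then show ?case using K2 by blast
next
  case (par V1 E1 V2 E2 s t)
  note b1 = tsp_basic[OF par(1)] and b2 = tsp_basic[OF par(2)]
  have False if F: "F \<subseteq> E1 \<union> E2" "reach F ends s t" "c \<notin> \<Union> (ends ` F)" for F
  proof -
    have "t \<in> \<Union> (ends ` W)"
      by (rule split_closed[OF F(2), of W W' "{c}"]) (use par(7,9,12) F in auto)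
    then have "t \<in> {c}" using par(9,13) by (metis IntI)
    then show False using par(11) by simp
  qed
  moreover have "c \<notin> V1 \<or> c \<notin> V2" using par(3,10,11) by (metis IntI insert_iff singletonD)
  ultimately show ?case using b1 b2 by (metis Un_upper1 Un_upper2)
next
  case (ser V1 E1 V2 E2 s d t)
  note b1 = tsp_basic[OF ser(1)] and b2 = tsp_basic[OF ser(2)]
  note VW = ser(9) and sW = ser(12) and tW = ser(13)
  have U: "\<Union> (ends ` E1) = V1" "\<Union> (ends ` E2) = V2" using b1 b2 by simp_all
  have d: "d \<in> V1" "d \<in> V2" using b1 b2 by simp_all
  have cW: "c \<in> \<Union> (ends ` W)" "c \<in> \<Union> (ends ` W')" using VW by (metis IntE singletonI)+
  have UW: "\<Union> (ends ` W) \<union> \<Union> (ends ` W') = V1 \<union> V2"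
    using ser(7) U by (metis Union_Un_distrib image_Un)
  have sW': "s \<notin> \<Union> (ends ` W')" and tW': "t \<notin> \<Union> (ends ` W)" using VW sW tW ser(10,11) by (metis IntI singletonD)+
  \<comment> \<open>Each edge of \<open>E2\<close> leads to t by a walk that avoids d, and hence c:
    either c is d, or c is not a vertex of this half. An edge in W would therefore put t on the
    wrong side.\<close>
  have E2: "E2 \<subseteq> W'" if "c = d \<or> c \<notin> V2"
  proof
    fix e assume e: "e \<in> E2"
    obtain u where u: "u \<in> ends e" "u \<noteq> d" "u \<in> V2" using tsp_other_end[OF ser(2) e] .
    then have r: "reach {e \<in> E2. d \<notin> ends e} ends u t" using tsp_avoid[OF ser(2)] by blast
    have "t \<in> \<Union> (ends ` W)" if "e \<in> W"
      by (rule split_closed[OF r, of W W' "{c}"]) (use ser(7,9) u that \<open>c = d \<or> c \<notin> V2\<close> b2 in auto)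
    then show "e \<in> W'" using tW' e ser(7) by blast
  qed
  have E1: "E1 \<subseteq> W" if "c = d \<or> c \<notin> V1"
  proof
    fix e assume e: "e \<in> E1"
    obtain u where u: "u \<in> ends e" "u \<noteq> d" "u \<in> V1" using tsp_other_end[OF ser(1) e] .
    then have r: "reach {e \<in> E1. d \<notin> ends e} ends u s" using tsp_avoid[OF ser(1)] by blast
    have "s \<in> \<Union> (ends ` W')" if "e \<in> W'"
      by (rule split_closed[OF r, of W' W "{c}"]) (use ser(7,9) u that \<open>c = d \<or> c \<notin> V1\<close> b1 in auto)
    then show "e \<in> W" using sW' e ser(7) by blast
  qed
  consider "c = d" | "c \<noteq> d" "c \<in> V1" "c \<notin> V2" | "c \<noteq> d" "c \<in> V2" "c \<notin> V1"
  proof -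
    have "c \<in> V1 \<union> V2" using cW(1) UW by blast
    then show thesis using that ser(3) by (metis IntI UnE singletonD)
  qed
  then show ?case
  proof cases
    case 1
    then have "E1 = W" "E2 = W'" using E1 E2 ser(4,7,8) by blast+
    then show ?thesis using 1 ser(1,2) U by simp
  next
    case 2
    have E2: "E2 \<subseteq> W'" using E2 2 by simp
    then have dW: "d \<in> \<Union> (ends ` W')" using U(2) d(2) by blast
    then have dW': "d \<notin> \<Union> (ends ` W)" using VW 2(1) by (metis IntI singletonD)
    have "tsp ends (\<Union> (ends ` W), W, s, c) \<and> tsp ends (\<Union> (ends ` (W' \<inter> E1)), W' \<inter> E1, c, d)"
    proof (rule ser(5))
      show "W \<union> W' \<inter> E1 = E1" using ser(4,7,8) E2 by blast
      show "W \<inter> (W' \<inter> E1) = {}" using ser(8) by blast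
      have "c \<in> \<Union> (ends ` (W' \<inter> E1))"
        using cW(2) 2(3) ser(7) tsp_ends[OF ser(2)] by blast
      moreover have "\<Union> (ends ` (W' \<inter> E1)) \<subseteq> \<Union> (ends ` W')" by blast
      ultimately show "\<Union> (ends ` W) \<inter> \<Union> (ends ` (W' \<inter> E1)) = {c}" using VW by auto
      have "d \<in> \<Union> (ends ` E1)" using U d by simp
      then show "d \<in> \<Union> (ends ` (W' \<inter> E1))" using dW' ser(7) by blast
    qed (use ser(10,12) 2 in auto)
    moreover have "tsp ends (\<Union> (ends ` (W' \<inter> E1)) \<union> V2, W' \<inter> E1 \<union> E2, c, t)"
      if "tsp ends (\<Union> (ends ` (W' \<inter> E1)), W' \<inter> E1, c, d)"
    proof (rule tsp_serI[OF that ser(2)])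
      have "\<Union> (ends ` (W' \<inter> E1)) \<subseteq> V1" "d \<in> \<Union> (ends ` (W' \<inter> E1))"
        using tsp_ends[OF ser(1)] tsp_basic[OF that] by blast+
      then show "\<Union> (ends ` (W' \<inter> E1)) \<inter> V2 = {d}" using ser(3) d by auto
    qed (use ser(4) in auto)
    moreover have "W' \<inter> E1 \<union> E2 = W'" using E2 ser(7) by blast
    moreover have "\<Union> (ends ` (W' \<inter> E1)) \<union> V2 = \<Union> (ends ` W')"
      using \<open>W' \<inter> E1 \<union> E2 = W'\<close> U by (metis Union_Un_distrib image_Un)
    ultimately show ?thesis by simp
  next
    case 3
    have E1: "E1 \<subseteq> W" using E1 3 by simp
    then have dW: "d \<in> \<Union> (ends ` W)" using U(1) d(1) by blast
    then have dW': "d \<notin> \<Union> (ends ` W')" using VW 3(1) by (metis IntI singletonD)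
    have "tsp ends (\<Union> (ends ` (W \<inter> E2)), W \<inter> E2, d, c) \<and> tsp ends (\<Union> (ends ` W'), W', c, t)"
    proof (rule ser(6))
      show "W \<inter> E2 \<union> W' = E2" using ser(4,7,8) E1 by blast
      show "W \<inter> E2 \<inter> W' = {}" using ser(8) by blast
      have "c \<in> \<Union> (ends ` (W \<inter> E2))"
        using cW(1) 3(3) ser(7) tsp_ends[OF ser(1)] by blast
      moreover have "\<Union> (ends ` (W \<inter> E2)) \<subseteq> \<Union> (ends ` W)" by blast
      ultimately show "\<Union> (ends ` (W \<inter> E2)) \<inter> \<Union> (ends ` W') = {c}" using VW by auto
      have "d \<in> \<Union> (ends ` E2)" using U d by simp
      then show "d \<in> \<Union> (ends ` (W \<inter> E2))" using dW' ser(7) by blast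
    qed (use ser(11,13) 3 in auto)
    moreover have "tsp ends (V1 \<union> \<Union> (ends ` (W \<inter> E2)), E1 \<union> W \<inter> E2, s, c)"
      if "tsp ends (\<Union> (ends ` (W \<inter> E2)), W \<inter> E2, d, c)"
    proof (rule tsp_serI[OF ser(1) that])
      have "\<Union> (ends ` (W \<inter> E2)) \<subseteq> V2" "d \<in> \<Union> (ends ` (W \<inter> E2))"
        using tsp_ends[OF ser(2)] tsp_basic[OF that] by blast+
      then show "V1 \<inter> \<Union> (ends ` (W \<inter> E2)) = {d}" using ser(3) d by auto
    qed (use ser(4) in auto)
    moreover have "E1 \<union> W \<inter> E2 = W" using E1 ser(7) by blast
    moreover have "V1 \<union> \<Union> (ends ` (W \<inter> E2)) = \<Union> (ends ` W)"
      using \<open>E1 \<union> W \<inter> E2 = W\<close> U by (metis Union_Un_distrib image_Un)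
    ultimately show ?thesis by simp
  qed
qed

lemma connected_graph_cover:
  assumes "connected_graph V E ends" "wf_graph V E ends" "a \<in> V" "b \<in> V" "a \<noteq> b"
  shows "\<Union> (ends ` E) = V"
proof
  show "\<Union> (ends ` E) \<subseteq> V" using assms(2) by (auto simp: wf_graph_def)
  show "V \<subseteq> \<Union> (ends ` E)"
  proof
    fix x assume x: "x \<in> V"
    obtain y where y: "y \<in> V" "y \<noteq> x" using assms by metis
    then have "(x, y) \<in> (adj E ends)\<^sup>*" using assms(1) x by (auto simp: connected_graph_def reach_def)
    then show "x \<in> \<Union> (ends ` E)" using y(2)
      by (cases rule: converse_rtranclE) (auto simp: adj_def)
  qed
qed

text \<open>Constituents are connected and have two distinct vertices, so their vertex sets are
  those covered by their edges. This brings the pieces into the form required by the splitting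
  lemmas.\<close>

lemma tsp_components:
  assumes X: "tsp ends X" and XY: "is_ser X X1 X2 \<or> is_par X X1 X2"
    and c1: "constituent ends V0 E0 X1" and c2: "constituent ends V0 E0 X2"
  shows "tsp ends X1 \<and> tsp ends X2"
proof -
  obtain V E s t V1 E1 s1 t1 V2 E2 s2 t2 where
    eq: "X = (V, E, s, t)" "X1 = (V1, E1, s1, t1)" "X2 = (V2, E2, s2, t2)"
    by (metis prod_cases4)
  have t1: "s1 \<noteq> t1" "s1 \<in> V1" "t1 \<in> V1" "wf_graph V1 E1 ends" "connected_graph V1 E1 ends"
    and t2: "s2 \<noteq> t2" "s2 \<in> V2" "t2 \<in> V2" "wf_graph V2 E2 ends" "connected_graph V2 E2 ends"
    using c1 c2 by (simp_all add: eq constituent_def two_terminal_def)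
  have V: "\<Union> (ends ` E1) = V1" "\<Union> (ends ` E2) = V2"
    using connected_graph_cover t1 t2 by metis+
  from XY show ?thesis
  proof
    assume "is_ser X X1 X2"
    then have h: "s = s1" "t1 = s2" "t = t2" "E1 \<union> E2 = E" "V1 \<inter> V2 = {t1}" "E1 \<inter> E2 = {}"
      by (auto simp: is_ser_def eq)
    show ?thesis
      using tsp_split_ser[of ends V E s t E1 E2 t1] X h t1 t2 unfolding eq V by simp
  next
    assume "is_par X X1 X2"
    then have h: "s1 = s" "t1 = t" "s2 = s" "t2 = t" "E = E1 \<union> E2" "V1 \<inter> V2 = {s, t}" "E1 \<inter> E2 = {}"
      by (auto simp: is_par_def eq)
    have "E - E1 = E2" "E - E2 = E1" using h by auto
    moreover have "E1 \<noteq> {}" "E2 \<noteq> {}" using V t1 t2 by auto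
    ultimately show ?thesis
      using tsp_split_par[of ends V E s t E1] tsp_split_par[of ends V E s t E2] X h V
      unfolding eq by (simp add: Int_commute)
  qed
qed

text \<open>Both pieces of a composition contain edges and share none, so each is strictly smaller
  than the whole, contrary to primality. Only the single edge is left.\<close>

lemma tsp_prime:
  assumes X: "tsp ends X" and prime: "prime_tg ends X"
  obtains s t e where "s \<noteq> t" "ends e = {s, t}" "X = ({s, t}, {e}, s, t)"
proof -
  have False if "tsp ends X1" "tsp ends X2" "is_ser X X1 X2 \<or> is_par X X1 X2" for X1 X2
  proof -
    obtain V E s t V1 E1 s1 t1 V2 E2 s2 t2 where
      eq: "X = (V, E, s, t)" "X1 = (V1, E1, s1, t1)" "X2 = (V2, E2, s2, t2)"
      by (metis prod_cases4)
    have "E1 \<noteq> {}" "E2 \<noteq> {}" using that tsp_nonempty unfolding eq by metis+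
    then have "strictly_smaller X1 X" "strictly_smaller X2 X"
      using that(3) by (auto simp: strictly_smaller_def eq is_ser_def is_par_def)
    then show False using prime that tsp_two_terminal unfolding prime_tg_def by blast
  qed
  note no_split = this
  from X show thesis
  proof (cases rule: tsp.cases)
    case (tsp_K2 s t e)
    then show ?thesis by (intro that[of s t e])
  qed (use no_split in blast)+
qed

lemma tsp_nodes:
  assumes "wf_dtree ends V E T" "tsp ends (lab T)" "X \<in> nodes T"
  shows "tsp ends X"
  using assms
proof (induction T)
  case (DSer x l r)
  have "constituent ends V E (lab l)" "constituent ends V E (lab r)"
    using DSer.prems by (cases l; cases r; simp)+
  then show ?case using DSer tsp_components[of ends x "lab l" "lab r"] by auto
next
  case (DPar x l r)
  have "constituent ends V E (lab l)" "constituent ends V E (lab r)"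
    using DPar.prems by (cases l; cases r; simp)+
  then show ?case using DPar tsp_components[of ends x "lab l" "lab r"] by auto
qed simp

section \<open>Effective weights\<close>

locale weight_sets =
  fixes q :: complex and L :: nat and S :: "nat \<Rightarrow> complex set"
  assumes q0: "q \<noteq> 0" and L2: "L \<ge> 2"
    and S_Suc: "1 \<le> k \<Longrightarrow> k < L - 1 \<Longrightarrow> S k \<subseteq> S (Suc k)"
    and S_ser: "1 \<le> k \<Longrightarrow> k \<le> L - 1 \<Longrightarrow> 1 \<le> l \<Longrightarrow> l \<le> L - 1 \<Longrightarrow> a \<in> S k \<Longrightarrow> b \<in> S l \<Longrightarrow>
      q + a + b \<noteq> 0 \<and> ser_conn q a b \<in> S (min k l)"
    and S_par: "1 \<le> k \<Longrightarrow> 1 \<le> l \<Longrightarrow> k + l \<le> L - 1 \<Longrightarrow> a \<in> S k \<Longrightarrow> b \<in> S l \<Longrightarrow>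
      par_conn a b \<in> S (k + l)"
begin

lemma S_mono:
  assumes "1 \<le> k" "k \<le> l" "l \<le> L - 1"
  shows "S k \<subseteq> S l"
  using assms(2,3,1)
proof (induction rule: dec_induct)
  case (step n)
  then show ?case using S_Suc[of n] by auto
qed simp

definition good :: "('e \<Rightarrow> 'v set) \<Rightarrow> ('e \<Rightarrow> complex) \<Rightarrow> 'v set \<Rightarrow> 'e set \<Rightarrow> 'v \<Rightarrow> 'v \<Rightarrow> bool" where
  "good ends v V E s t \<longleftrightarrow> partA V E ends s t q v \<noteq> 0 \<and>
     partB V E ends s t q v / partA V E ends s t q v \<in> S (lambda E ends s t)"

lemma good_edge: "s \<noteq> t \<Longrightarrow> ends e = {s, t} \<Longrightarrow> v e \<in> S 1 \<Longrightarrow> good ends v {s, t} {e} s t"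
  by (simp add: good_def part_edge[OF q0] lambda_edge)

text \<open>The sets S are controlled from index 1 on, so each use of conditions (1) and (2)
  requires a positive flow.\<close>

lemma tsp_lambda_pos: "tsp ends (V, E, s, t) \<Longrightarrow> 1 \<le> lambda E ends s t"
  by (rule lambda_pos) (auto dest: tsp_basic simp: wf_graph_def)

lemma good_series:
  assumes X1: "tsp ends (V1, E1, s, c)" and X2: "tsp ends (V2, E2, c, t)"
    and V: "V1 \<inter> V2 = {c}" and E: "E1 \<inter> E2 = {}"
    and g1: "good ends v V1 E1 s c" and g2: "good ends v V2 E2 c t"
    and l: "lambda E1 ends s c \<le> L - 1" "lambda E2 ends c t \<le> L - 1"
  shows "good ends v (V1 \<union> V2) (E1 \<union> E2) s t"
proof -
  note b1 = tsp_basic[OF X1] and b2 = tsp_basic[OF X2]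
  define A1 where "A1 = partA V1 E1 ends s c q v"
  define B1 where "B1 = partB V1 E1 ends s c q v"
  define A2 where "A2 = partA V2 E2 ends c t q v"
  define B2 where "B2 = partB V2 E2 ends c t q v"
  have A: "A1 \<noteq> 0" "A2 \<noteq> 0"
    and B: "B1 / A1 \<in> S (lambda E1 ends s c)" "B2 / A2 \<in> S (lambda E2 ends c t)"
    using g1 g2 by (simp_all add: good_def A1_def A2_def B1_def B2_def)
  note S = S_ser[OF tsp_lambda_pos[OF X1] l(1) tsp_lambda_pos[OF X2] l(2) B]
  have "partA (V1 \<union> V2) (E1 \<union> E2) ends s t q v = q * A1 * A2 + A1 * B2 + B1 * A2"
    "partB (V1 \<union> V2) (E1 \<union> E2) ends s t q v = B1 * B2"
    using part_series[of V1 E1 ends V2 E2 q c s t v] b1 b2 V E q0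
    by (simp_all add: A1_def A2_def B1_def B2_def)
  \<comment> \<open>In this factorisation the last factor is the quantity that condition (1) keeps
    away from 0, so A of the composition does not vanish.\<close>
  moreover have eq: "q * A1 * A2 + A1 * B2 + B1 * A2 = A1 * A2 * (q + B1 / A1 + B2 / A2)"
    using A by (simp add: field_simps)
  moreover have "B1 * B2 / (A1 * A2 * (q + B1 / A1 + B2 / A2)) = ser_conn q (B1 / A1) (B2 / A2)"
    using A by (simp add: ser_conn_def)
  moreover have "lambda (E1 \<union> E2) ends s t = min (lambda E1 ends s c) (lambda E2 ends c t)"
    by (rule lambda_series) (use b1 b2 V E in auto)
  ultimately show ?thesis using S A by (simp add: good_def)
qed

text \<open>Kept free of any flow bound, because it also has to cover a block of flow L, for which
  no set S is available.\<close>

lemma parallel_weight: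
  assumes X1: "tsp ends (V1, E1, s, t)" and X2: "tsp ends (V2, E2, s, t)"
    and V: "V1 \<inter> V2 = {s, t}" and E: "E1 \<inter> E2 = {}"
    and A: "partA V1 E1 ends s t q v \<noteq> 0" "partA V2 E2 ends s t q v \<noteq> 0"
  shows "partA (V1 \<union> V2) (E1 \<union> E2) ends s t q v \<noteq> 0"
    and "partB (V1 \<union> V2) (E1 \<union> E2) ends s t q v / partA (V1 \<union> V2) (E1 \<union> E2) ends s t q v =
      par_conn (partB V1 E1 ends s t q v / partA V1 E1 ends s t q v)
        (partB V2 E2 ends s t q v / partA V2 E2 ends s t q v)"
  using part_parallel[of V1 E1 ends V2 E2 q s t v] tsp_basic[OF X1] tsp_basic[OF X2] V E q0 A
  by (simp_all add: par_conn_def field_simps)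

lemma tsp_lambda_parallel:
  assumes "tsp ends (V1, E1, s, t)" "tsp ends (V2, E2, s, t)" "V1 \<inter> V2 = {s, t}" "E1 \<inter> E2 = {}"
  shows "lambda (E1 \<union> E2) ends s t = lambda E1 ends s t + lambda E2 ends s t"
  using tsp_basic[OF assms(1)] tsp_basic[OF assms(2)] assms(3,4)
  by (intro lambda_parallel) auto

lemma good_parallel:
  assumes X1: "tsp ends (V1, E1, s, t)" and X2: "tsp ends (V2, E2, s, t)"
    and V: "V1 \<inter> V2 = {s, t}" and E: "E1 \<inter> E2 = {}"
    and g1: "good ends v V1 E1 s t" and g2: "good ends v V2 E2 s t"
    and l: "lambda (E1 \<union> E2) ends s t \<le> L - 1"
  shows "good ends v (V1 \<union> V2) (E1 \<union> E2) s t"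
proof -
  note lam = tsp_lambda_parallel[OF X1 X2 V E]
  have "par_conn (partB V1 E1 ends s t q v / partA V1 E1 ends s t q v)
      (partB V2 E2 ends s t q v / partA V2 E2 ends s t q v) \<in> S (lambda (E1 \<union> E2) ends s t)"
    unfolding lam
    by (rule S_par[OF tsp_lambda_pos[OF X1] tsp_lambda_pos[OF X2]]) (use l lam g1 g2 in \<open>auto simp: good_def\<close>)
  then show ?thesis
    using parallel_weight[OF X1 X2 V E] g1 g2 by (simp add: good_def)
qed

lemma lab_in_nodes: "lab T \<in> nodes T"
  by (cases T) auto

lemma proper_nodes_subset: "proper_nodes T \<subseteq> nodes T"
  by (cases T) auto

text \<open>Both children of the root are proper constituents, so every node of either subtree
  satisfies the flow bound and is good by induction. Only the root has to be examined.\<close>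

lemma good_nodes:
  assumes "wf_dtree ends V0 E0 T" "tsp ends (lab T)" "maximal_dtree ends T"
    and "\<forall>(Vh, Eh, a, b) \<in> proper_nodes T. lambda Eh ends a b \<le> L - 1"
    and "\<forall>e \<in> fst (snd (lab T)). v e \<in> S 1"
    and "(V, E, s, t) \<in> nodes T" "lambda E ends s t \<le> L - 1"
  shows "good ends v V E s t"
  using assms
proof (induction T arbitrary: V E s t)
  case (DLeaf x)
  then have x: "x = (V, E, s, t)" "tsp ends x" "prime_tg ends x" by (auto simp: maximal_dtree_def)
  obtain s' t' e where e: "s' \<noteq> t'" "ends e = {s', t'}" "x = ({s', t'}, {e}, s', t')"
    by (rule tsp_prime[OF x(2,3)])
  then have "V = {s, t}" "E = {e}" "s' = s" "t' = t" using x(1) by auto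
  then show ?case using good_edge[of s t ends e v] e DLeaf.prems(5) by simp
next
  case (DSer x l r)
  obtain V1 E1 s1 t1 where l: "lab l = (V1, E1, s1, t1)" by (metis prod_cases4)
  obtain V2 E2 s2 t2 where r: "lab r = (V2, E2, s2, t2)" by (metis prod_cases4)
  obtain V' E' s' t' where x: "x = (V', E', s', t')" by (metis prod_cases4)
  have h: "s' = s1" "t1 = s2" "t' = t2" "V' = V1 \<union> V2" "E' = E1 \<union> E2" "V1 \<inter> V2 = {t1}" "E1 \<inter> E2 = {}"
    using DSer.prems(1) by (auto simp: is_ser_def l r x)
  have tsp: "tsp ends (lab l)" "tsp ends (lab r)"
    using tsp_nodes[OF DSer.prems(1,2)] lab_in_nodes[of l] lab_in_nodes[of r] by auto
  have max: "maximal_dtree ends l" "maximal_dtree ends r"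
    using DSer.prems(3) by (auto simp: maximal_dtree_def)
  have pl: "\<forall>(Vh, Eh, a, b) \<in> nodes l. lambda Eh ends a b \<le> L - 1"
    and pr: "\<forall>(Vh, Eh, a, b) \<in> nodes r. lambda Eh ends a b \<le> L - 1"
    using DSer.prems(4) by auto
  have w: "\<forall>e\<in>fst (snd (lab l)). v e \<in> S 1" "\<forall>e\<in>fst (snd (lab r)). v e \<in> S 1"
    using DSer.prems(5) h by (auto simp: l r x)
  have gl: "good ends v Vh Eh a b" if "(Vh, Eh, a, b) \<in> nodes l" for Vh Eh a b
    by (rule DSer.IH(1)) (use DSer.prems(1) tsp max pl w that proper_nodes_subset[of l] in auto)
  have gr: "good ends v Vh Eh a b" if "(Vh, Eh, a, b) \<in> nodes r" for Vh Eh a b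
    by (rule DSer.IH(2)) (use DSer.prems(1) tsp max pr w that proper_nodes_subset[of r] in auto)
  have "good ends v V' E' s' t'"
    unfolding h
  proof (rule good_series)
    show "tsp ends (V1, E1, s1, s2)" "tsp ends (V2, E2, s2, t2)" using tsp h l r by auto
    show "good ends v V1 E1 s1 s2" "good ends v V2 E2 s2 t2"
      using gl[of V1 E1 s1 s2] gr[of V2 E2 s2 t2] lab_in_nodes[of l] lab_in_nodes[of r] l r h by auto
    show "lambda E1 ends s1 s2 \<le> L - 1" "lambda E2 ends s2 t2 \<le> L - 1"
      using pl pr lab_in_nodes[of l] lab_in_nodes[of r] l r h by auto
  qed (use h in auto)
  then show ?case using DSer.prems(6) gl gr x by auto
next
  case (DPar x l r)
  obtain V1 E1 s1 t1 where l: "lab l = (V1, E1, s1, t1)" by (metis prod_cases4)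
  obtain V2 E2 s2 t2 where r: "lab r = (V2, E2, s2, t2)" by (metis prod_cases4)
  obtain V' E' s' t' where x: "x = (V', E', s', t')" by (metis prod_cases4)
  have h: "s1 = s'" "t1 = t'" "s2 = s'" "t2 = t'" "V' = V1 \<union> V2" "E' = E1 \<union> E2"
      "V1 \<inter> V2 = {s', t'}" "E1 \<inter> E2 = {}"
    using DPar.prems(1) by (auto simp: is_par_def l r x)
  have tsp: "tsp ends (lab l)" "tsp ends (lab r)"
    using tsp_nodes[OF DPar.prems(1,2)] lab_in_nodes[of l] lab_in_nodes[of r] by auto
  have max: "maximal_dtree ends l" "maximal_dtree ends r"
    using DPar.prems(3) by (auto simp: maximal_dtree_def)
  have pl: "\<forall>(Vh, Eh, a, b) \<in> nodes l. lambda Eh ends a b \<le> L - 1"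
    and pr: "\<forall>(Vh, Eh, a, b) \<in> nodes r. lambda Eh ends a b \<le> L - 1"
    using DPar.prems(4) by auto
  have w: "\<forall>e\<in>fst (snd (lab l)). v e \<in> S 1" "\<forall>e\<in>fst (snd (lab r)). v e \<in> S 1"
    using DPar.prems(5) h by (auto simp: l r x)
  have gl: "good ends v Vh Eh a b" if "(Vh, Eh, a, b) \<in> nodes l" for Vh Eh a b
    by (rule DPar.IH(1)) (use DPar.prems(1) tsp max pl w that proper_nodes_subset[of l] in auto)
  have gr: "good ends v Vh Eh a b" if "(Vh, Eh, a, b) \<in> nodes r" for Vh Eh a b
    by (rule DPar.IH(2)) (use DPar.prems(1) tsp max pr w that proper_nodes_subset[of r] in auto)
  \<comment> \<open>Flows add here, so the root may exceed the bound although its children obey it;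
    at a series node the minimum makes this impossible.\<close>
  have "good ends v V' E' s' t'" if "lambda E' ends s' t' \<le> L - 1"
    unfolding h(5,6)
  proof (rule good_parallel)
    show "tsp ends (V1, E1, s', t')" "tsp ends (V2, E2, s', t')" using tsp h l r by auto
    show "good ends v V1 E1 s' t'" "good ends v V2 E2 s' t'"
      using gl[of V1 E1 s' t'] gr[of V2 E2 s' t'] lab_in_nodes[of l] lab_in_nodes[of r] l r h by auto
  qed (use h that in auto)
  then show ?case using DPar.prems(6,7) gl gr x by auto
qed

text \<open>E' is a connection between the terminals outside the constituent. When passing to a
  piece, the edges of its sibling are moved into E', so E \<union> E' remains the same edge set and
  its flow bound is inherited.\<close>

lemma good_if_outside_connection:
  assumes "tsp ends (V, E, s, t)" "finite E'" "E \<inter> E' = {}" "reach E' ends s t"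
    and "\<And>x y. x \<in> V \<Longrightarrow> y \<in> V \<Longrightarrow> x \<noteq> y \<Longrightarrow> lambda (E \<union> E') ends x y \<le> L"
    and "\<forall>e\<in>E. v e \<in> S 1"
  shows "good ends v V E s t \<and> lambda E ends s t \<le> L - 1"
proof -
  \<comment> \<open>Formulated for every constituent with its own outside set: E' supplies at least
    one path disjoint from E, and the total is at most L.\<close>
  have bound: "lambda E ends s t \<le> L - 1"
    if "tsp ends (V, E, s, t)" "finite E'" "E \<inter> E' = {}" "reach E' ends s t"
      "\<And>x y. x \<in> V \<Longrightarrow> y \<in> V \<Longrightarrow> x \<noteq> y \<Longrightarrow> lambda (E \<union> E') ends x y \<le> L" for V E s t E'
  proof -
    note b = tsp_basic[OF that(1)]
    have "lambda E ends s t + lambda E' ends s t \<le> lambda (E \<union> E') ends s t"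
      by (rule lambda_add_le) (use that b in \<open>auto simp: wf_graph_def\<close>)
    moreover have "lambda (E \<union> E') ends s t \<le> L" using that(5) b by blast
    moreover have "1 \<le> lambda E' ends s t" using lambda_pos that(2,4) b by metis
    ultimately show ?thesis by linarith
  qed
  have "good ends v V E s t"
    using assms
  proof (induction arbitrary: E' rule: tsp_tuple_induct)
    case (K2 s t e)
    then show ?case by (auto intro: good_edge)
  next
    case (ser V1 E1 V2 E2 s c t)
    note b1 = tsp_basic[OF ser(1)] and b2 = tsp_basic[OF ser(2)]
    have fin: "finite (E' \<union> E2)" "finite (E' \<union> E1)"
      using ser(7) b1 b2 by (auto simp: wf_graph_def)
    have dis: "E1 \<inter> (E' \<union> E2) = {}" "E2 \<inter> (E' \<union> E1) = {}" using ser(4,8) by auto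
    have m: "reach (E' \<union> F) ends x y" if "reach E' ends x y \<or> reach F ends x y" for F x y
      using that by (meson reach_mono Un_upper1 Un_upper2)
    \<comment> \<open>Outside the first piece one goes from s to t through E' and back to c through
      the second piece; symmetrically for the other one.\<close>
    have r: "reach (E' \<union> E2) ends s c" "reach (E' \<union> E1) ends c t"
      using m ser(9) b1 b2 by (meson reach_trans reach_sym)+
    have u: "E1 \<union> (E' \<union> E2) = E1 \<union> E2 \<union> E'" "E2 \<union> (E' \<union> E1) = E1 \<union> E2 \<union> E'" by auto
    have l1: "lambda (E1 \<union> (E' \<union> E2)) ends x y \<le> L" if "x \<in> V1" "y \<in> V1" "x \<noteq> y" for x y
      unfolding u using ser(10) that by blast
    have l2: "lambda (E2 \<union> (E' \<union> E1)) ends x y \<le> L" if "x \<in> V2" "y \<in> V2" "x \<noteq> y" for x y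
      unfolding u using ser(10) that by blast
    show ?case
    proof (rule good_series[OF ser(1-4)])
      show "good ends v V1 E1 s c" by (rule ser(5)[OF fin(1) dis(1) r(1) l1]) (use ser(11) in auto)
      show "good ends v V2 E2 c t" by (rule ser(6)[OF fin(2) dis(2) r(2) l2]) (use ser(11) in auto)
    qed (use bound[OF ser(1) fin(1) dis(1) r(1) l1] bound[OF ser(2) fin(2) dis(2) r(2) l2] in auto)
  next
    case (par V1 E1 V2 E2 s t)
    note b1 = tsp_basic[OF par(1)] and b2 = tsp_basic[OF par(2)]
    have fin: "finite (E' \<union> E2)" "finite (E' \<union> E1)"
      using par(7) b1 b2 by (auto simp: wf_graph_def)
    have dis: "E1 \<inter> (E' \<union> E2) = {}" "E2 \<inter> (E' \<union> E1) = {}" using par(4,8) by auto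
    have r: "reach (E' \<union> E2) ends s t" "reach (E' \<union> E1) ends s t"
      using par(9) by (meson reach_mono Un_upper1)+
    have u: "E1 \<union> (E' \<union> E2) = E1 \<union> E2 \<union> E'" "E2 \<union> (E' \<union> E1) = E1 \<union> E2 \<union> E'" by auto
    have l1: "lambda (E1 \<union> (E' \<union> E2)) ends x y \<le> L" if "x \<in> V1" "y \<in> V1" "x \<noteq> y" for x y
      unfolding u using par(10) that by blast
    have l2: "lambda (E2 \<union> (E' \<union> E1)) ends x y \<le> L" if "x \<in> V2" "y \<in> V2" "x \<noteq> y" for x y
      unfolding u using par(10) that by blast
    show ?case
    proof (rule good_parallel[OF par(1-4)])
      show "good ends v V1 E1 s t" by (rule par(5)[OF fin(1) dis(1) r(1) l1]) (use par(11) in auto)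
      show "good ends v V2 E2 s t" by (rule par(6)[OF fin(2) dis(2) r(2) l2]) (use par(11) in auto)
      show "lambda (E1 \<union> E2) ends s t \<le> L - 1"
        by (rule bound[OF tsp_parI[OF par(1-4)] par(7-9)]) (use par(10) in auto)
    qed
  qed
  with bound[OF assms(1-5)] show ?thesis by blast
qed

end

section \<open>Series-parallel graphs\<close>

text \<open>A static description by blocks. A series composition has no clause of its own, being a
  join at its middle vertex, and disconnected graphs arise from joins with empty
  intersection.\<close>

inductive glued :: "('e \<Rightarrow> 'v set) \<Rightarrow> 'v set \<Rightarrow> 'e set \<Rightarrow> bool" for ends where
  glued_edgeless: "finite V \<Longrightarrow> glued ends V {}"
| glued_edge: "\<lbrakk>s \<noteq> t; ends e = {s, t}\<rbrakk> \<Longrightarrow> glued ends {s, t} {e}"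
| glued_par: "\<lbrakk>tsp ends (V1, E1, s, t); tsp ends (V2, E2, s, t); V1 \<inter> V2 = {s, t}; E1 \<inter> E2 = {}\<rbrakk>
    \<Longrightarrow> glued ends (V1 \<union> V2) (E1 \<union> E2)"
| glued_join: "\<lbrakk>glued ends V1 E1; glued ends V2 E2; card (V1 \<inter> V2) \<le> 1; E1 \<inter> E2 = {}\<rbrakk>
    \<Longrightarrow> glued ends (V1 \<union> V2) (E1 \<union> E2)"

lemma glued_basic: "glued ends V E \<Longrightarrow> wf_graph V E ends \<and> loopless E ends"
proof (induction rule: glued.induct)
  case (glued_par V1 E1 s t V2 E2)
  then show ?case using tsp_basic[OF tsp_parI[OF glued_par]] by blast
qed (auto simp: wf_graph_def loopless_def)

lemma glued_cong:
  assumes "glued ends V E" "\<And>e. e \<in> E \<Longrightarrow> ends e = ends' e"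
  shows "glued ends' V E"
  using assms
proof (induction rule: glued.induct)
  case (glued_par V1 E1 s t V2 E2)
  then show ?case by (intro glued.glued_par[of ends' V1 E1 s t]) (auto intro: tsp_cong)
next
  case (glued_join V1 E1 V2 E2)
  then show ?case by (intro glued.glued_join) auto
next
  case (glued_edge s t e)
  then show ?case by (intro glued.glued_edge) auto
qed (auto intro: glued.intros)

text \<open>Covers both generating operations at once. Two endpoint maps occur because an operation
  redefines the map and may reuse the name of the removed edge.\<close>

lemma tsp_substitute:
  assumes "tsp ends (V, E, s, t)" "e \<in> E" "ends e = {x, y}" "tsp ends' (VR, ER, x, y)"
    and "VR \<inter> V = {x, y}" "ER \<inter> (E - {e}) = {}" "\<And>f. f \<in> E - {e} \<Longrightarrow> ends f = ends' f"
  shows "tsp ends' (V \<union> VR, E - {e} \<union> ER, s, t)"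
  using assms(1,2,5-)
proof (induction rule: tsp_tuple_induct)
  case (K2 s t f)
  \<comment> \<open>The terminals may meet x and y in either order, which is where
    \<open>tsp_reverse\<close> enters.\<close>
  have "f = e" "s = x \<and> t = y \<or> s = y \<and> t = x"
    using K2 assms(3) by (auto simp: doubleton_eq_iff)
  moreover have "{x, y} \<union> VR = VR" using tsp_basic[OF assms(4)] by auto
  ultimately show ?case using assms(4) tsp_reverse[OF assms(4)] by (auto simp: insert_commute)
next
  case (ser V1 E1 V2 E2 s c t)
  consider "e \<in> E1" "e \<notin> E2" | "e \<in> E2" "e \<notin> E1" using ser(4,7) by auto
  then show ?case
  proof cases
    case 1
    have xy: "{x, y} \<subseteq> V1" using tsp_ends[OF ser(1) 1(1)] assms(3) by simp
    have "tsp ends' (V1 \<union> VR, E1 - {e} \<union> ER, s, c)"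
      by (rule ser(5)) (use ser(8-10) xy 1 in auto)
    moreover have "tsp ends' (V2, E2, c, t)" using tsp_cong[OF ser(2)] ser(10) 1 by auto
    moreover have "(V1 \<union> VR) \<inter> V2 = {c}" using ser(3,8) xy by auto
    moreover have "(E1 - {e} \<union> ER) \<inter> E2 = {}" using ser(4,9) 1 by auto
    ultimately have "tsp ends' (V1 \<union> VR \<union> V2, E1 - {e} \<union> ER \<union> E2, s, t)" by (rule tsp_serI)
    moreover have "V1 \<union> VR \<union> V2 = V1 \<union> V2 \<union> VR" "E1 - {e} \<union> ER \<union> E2 = E1 \<union> E2 - {e} \<union> ER"
      using 1 by auto
    ultimately show ?thesis by simp
  next
    case 2
    have xy: "{x, y} \<subseteq> V2" using tsp_ends[OF ser(2) 2(1)] assms(3) by simp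
    have "tsp ends' (V2 \<union> VR, E2 - {e} \<union> ER, c, t)"
      by (rule ser(6)) (use ser(8-10) xy 2 in auto)
    moreover have "tsp ends' (V1, E1, s, c)" using tsp_cong[OF ser(1)] ser(10) 2 by auto
    moreover have "V1 \<inter> (V2 \<union> VR) = {c}" using ser(3,8) xy by auto
    moreover have "E1 \<inter> (E2 - {e} \<union> ER) = {}" using ser(4,9) 2 by auto
    ultimately have "tsp ends' (V1 \<union> (V2 \<union> VR), E1 \<union> (E2 - {e} \<union> ER), s, t)" by (metis tsp_serI)
    moreover have "V1 \<union> (V2 \<union> VR) = V1 \<union> V2 \<union> VR" "E1 \<union> (E2 - {e} \<union> ER) = E1 \<union> E2 - {e} \<union> ER"
      using 2 by auto
    ultimately show ?thesis by simp
  qed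
next
  case (par V1 E1 V2 E2 s t)
  consider "e \<in> E1" "e \<notin> E2" | "e \<in> E2" "e \<notin> E1" using par(4,7) by auto
  then show ?case
  proof cases
    case 1
    have xy: "{x, y} \<subseteq> V1" using tsp_ends[OF par(1) 1(1)] assms(3) by simp
    have "tsp ends' (V1 \<union> VR, E1 - {e} \<union> ER, s, t)"
      by (rule par(5)) (use par(8-10) xy 1 in auto)
    moreover have "tsp ends' (V2, E2, s, t)" using tsp_cong[OF par(2)] par(10) 1 by auto
    moreover have "(V1 \<union> VR) \<inter> V2 = {s, t}" using par(3,8) xy by auto
    moreover have "(E1 - {e} \<union> ER) \<inter> E2 = {}" using par(4,9) 1 by auto
    ultimately have "tsp ends' (V1 \<union> VR \<union> V2, E1 - {e} \<union> ER \<union> E2, s, t)" by (rule tsp_parI)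
    moreover have "V1 \<union> VR \<union> V2 = V1 \<union> V2 \<union> VR" "E1 - {e} \<union> ER \<union> E2 = E1 \<union> E2 - {e} \<union> ER"
      using 1 by auto
    ultimately show ?thesis by simp
  next
    case 2
    have xy: "{x, y} \<subseteq> V2" using tsp_ends[OF par(2) 2(1)] assms(3) by simp
    have "tsp ends' (V2 \<union> VR, E2 - {e} \<union> ER, s, t)"
      by (rule par(6)) (use par(8-10) xy 2 in auto)
    moreover have "tsp ends' (V1, E1, s, t)" using tsp_cong[OF par(1)] par(10) 2 by auto
    moreover have "V1 \<inter> (V2 \<union> VR) = {s, t}" using par(3,8) xy by auto
    moreover have "E1 \<inter> (E2 - {e} \<union> ER) = {}" using par(4,9) 2 by auto
    ultimately have "tsp ends' (V1 \<union> (V2 \<union> VR), E1 \<union> (E2 - {e} \<union> ER), s, t)" by (metis tsp_parI)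
    moreover have "V1 \<union> (V2 \<union> VR) = V1 \<union> V2 \<union> VR" "E1 \<union> (E2 - {e} \<union> ER) = E1 \<union> E2 - {e} \<union> ER"
      using 2 by auto
    ultimately show ?thesis by simp
  qed
qed

text \<open>The inserted graph must be known in both forms: as a two-terminal graph when e lies
  inside a parallel block, and as a glued graph when e is a block by itself.\<close>

lemma glued_substitute:
  assumes "glued ends V E" "e \<in> E" "ends e = {x, y}"
    and R: "tsp ends' (VR, ER, x, y)" "glued ends' VR ER"
    and "VR \<inter> V = {x, y}" "ER \<inter> (E - {e}) = {}" "\<And>f. f \<in> E - {e} \<Longrightarrow> ends f = ends' f"
  shows "glued ends' (V \<union> VR) (E - {e} \<union> ER)"
  using assms(1,2,6-)
proof (induction rule: glued.induct)
  case (glued_edgeless V)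
  then show ?case by simp
next
  case (glued_edge s t f)
  have "f = e" using glued_edge by simp
  moreover have "{s, t} \<union> VR = VR"
    using glued_edge \<open>f = e\<close> assms(3) tsp_basic[OF R(1)] by auto
  ultimately show ?case using R(2) by simp
next
  case (glued_par V1 E1 s t V2 E2)
  \<comment> \<open>The pieces are generalised so that an edge of the second one is handled by
    exchanging their roles.\<close>
  have *: "glued ends' (V1 \<union> V2 \<union> VR) (E1 \<union> E2 - {e} \<union> ER)"
    if h: "tsp ends (V1, E1, s, t)" "tsp ends (V2, E2, s, t)" "V1 \<inter> V2 = {s, t}" "E1 \<inter> E2 = {}" "e \<in> E1"
      "VR \<inter> (V1 \<union> V2) = {x, y}" "ER \<inter> (E1 \<union> E2 - {e}) = {}"
      "\<And>f. f \<in> E1 \<union> E2 - {e} \<Longrightarrow> ends f = ends' f" for V1 E1 V2 E2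
  proof -
    have e: "e \<notin> E2" using h by auto
    have xy: "{x, y} \<subseteq> V1" using tsp_ends[OF h(1,5)] assms(3) by simp
    have "tsp ends' (V1 \<union> VR, E1 - {e} \<union> ER, s, t)"
      by (rule tsp_substitute[OF h(1,5) assms(3) R(1)]) (use h(6-8) xy in auto)
    moreover have "tsp ends' (V2, E2, s, t)" using tsp_cong[OF h(2)] h(8) e by auto
    moreover have "(V1 \<union> VR) \<inter> V2 = {s, t}" using h(3,6) xy by auto
    moreover have "(E1 - {e} \<union> ER) \<inter> E2 = {}" using h(4,7) e by auto
    ultimately have "glued ends' (V1 \<union> VR \<union> V2) (E1 - {e} \<union> ER \<union> E2)" by (rule glued.glued_par)
    moreover have "V1 \<union> VR \<union> V2 = V1 \<union> V2 \<union> VR" "E1 - {e} \<union> ER \<union> E2 = E1 \<union> E2 - {e} \<union> ER"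
      using e by auto
    ultimately show ?thesis by simp
  qed
  show ?case
  proof (cases "e \<in> E1")
    case True
    show ?thesis by (rule *) (use glued_par True in auto)
  next
    case False
    have "glued ends' (V2 \<union> V1 \<union> VR) (E2 \<union> E1 - {e} \<union> ER)"
      by (rule *) (use glued_par False in auto)
    then show ?thesis by (simp add: Un_commute)
  qed
next
  case (glued_join V1 E1 V2 E2)
  have *: "glued ends' (V1 \<union> V2 \<union> VR) (E1 \<union> E2 - {e} \<union> ER)"
    if h: "glued ends V1 E1" "glued ends V2 E2" "card (V1 \<inter> V2) \<le> 1" "E1 \<inter> E2 = {}" "e \<in> E1"
      "VR \<inter> (V1 \<union> V2) = {x, y}" "ER \<inter> (E1 \<union> E2 - {e}) = {}"
      "\<And>f. f \<in> E1 \<union> E2 - {e} \<Longrightarrow> ends f = ends' f"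
      and IH: "VR \<inter> V1 = {x, y} \<Longrightarrow> ER \<inter> (E1 - {e}) = {} \<Longrightarrow>
        (\<And>f. f \<in> E1 - {e} \<Longrightarrow> ends f = ends' f) \<Longrightarrow> glued ends' (V1 \<union> VR) (E1 - {e} \<union> ER)"
    for V1 E1 V2 E2
  proof -
    have e: "e \<notin> E2" using h by auto
    have xy: "{x, y} \<subseteq> V1" using glued_basic[OF h(1)] h(5) assms(3) by (auto simp: wf_graph_def)
    have "glued ends' (V1 \<union> VR) (E1 - {e} \<union> ER)"
      by (rule IH) (use h(6-8) xy in auto)
    moreover have "glued ends' V2 E2" using glued_cong[OF h(2)] h(8) e by auto
    moreover have "(V1 \<union> VR) \<inter> V2 = V1 \<inter> V2" using h(6) xy by auto
    then have "card ((V1 \<union> VR) \<inter> V2) \<le> 1" using h(3) by simp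
    moreover have "(E1 - {e} \<union> ER) \<inter> E2 = {}" using h(4,7) e by auto
    ultimately have "glued ends' (V1 \<union> VR \<union> V2) (E1 - {e} \<union> ER \<union> E2)" by (rule glued.glued_join)
    moreover have "V1 \<union> VR \<union> V2 = V1 \<union> V2 \<union> VR" "E1 - {e} \<union> ER \<union> E2 = E1 \<union> E2 - {e} \<union> ER"
      using e by auto
    ultimately show ?thesis by simp
  qed
  show ?case
  proof (cases "e \<in> E1")
    case True
    show ?thesis by (rule *) (use glued_join True in auto)
  next
    case False
    have "glued ends' (V2 \<union> V1 \<union> VR) (E2 \<union> E1 - {e} \<union> ER)"
      by (rule *) (use glued_join False in \<open>auto simp: Int_commute\<close>)
    then show ?thesis by (simp add: Un_commute)
  qed
qed

section \<open>Block decomposition of forests and series-parallel graphs\<close>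

lemma forest_subgraph:
  assumes "forest V E ends" "E' \<subseteq> E" "V' \<subseteq> V" "\<And>e. e \<in> E' \<Longrightarrow> ends e \<subseteq> V'"
  shows "forest V' E' ends"
proof -
  have "\<not> reach (E' - {e}) ends x y" if "e \<in> E'" "ends e = {x, y}" for e x y
    using assms(1,2) that reach_mono[of "E' - {e}" ends x y "E - {e}"] unfolding forest_def by blast
  then show ?thesis using assms
    by (auto simp: forest_def wf_graph_def loopless_def dest: finite_subset)
qed

text \<open>Removing an edge xy cuts off the component \<open>V1\<close> of x. It meets the edge in
  x alone, and the result meets the remaining vertices in y alone, so two joins rebuild the forest.
  The remainder may be disconnected, which is why the induction is over forests rather than
  trees.\<close>

lemma forest_glued: "forest V E ends \<Longrightarrow> glued ends V E"
proof (induction "card E" arbitrary: V E rule: less_induct)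
  case less
  have wf: "wf_graph V E ends" and ll: "loopless E ends" using less.prems by (auto simp: forest_def)
  show ?case
  proof (cases "E = {}")
    case True
    then show ?thesis using wf by (auto simp: wf_graph_def intro: glued_edgeless)
  next
    case False
    then obtain e where e: "e \<in> E" by blast
    obtain x y where xy: "ends e = {x, y}" "x \<in> V" "y \<in> V" using wf_graph_ends[OF wf e] .
    have ne: "x \<noteq> y" using ll e xy by (auto simp: loopless_def)
    have nr: "\<not> reach (E - {e}) ends x y" using less.prems e xy by (auto simp: forest_def)
    define V1 where "V1 = {z \<in> V. reach (E - {e}) ends x z}"
    define E1 where "E1 = {f \<in> E - {e}. ends f \<subseteq> V1}"
    define E2 where "E2 = E - {e} - E1"
    have E2: "ends f \<subseteq> V - V1" if "f \<in> E2" for f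
    proof -
      have f: "f \<in> E" "f \<in> E - {e}" "\<not> ends f \<subseteq> V1" using that by (auto simp: E2_def E1_def)
      obtain a b where ab: "ends f = {a, b}" "a \<in> V" "b \<in> V" using wf_graph_ends[OF wf f(1)] .
      have "reach (E - {e}) ends a b" using f ab by (blast intro: reach_edge)
      then have "a \<in> V1 \<longleftrightarrow> b \<in> V1" unfolding V1_def using ab by (metis (lifting) mem_Collect_eq reach_sym reach_trans)
      then show ?thesis using ab f by auto
    qed
    have fin: "finite E" using wf by (simp add: wf_graph_def)
    have c: "card E1 < card E" "card E2 < card E"
      by (intro psubset_card_mono fin; use e in \<open>auto simp: E1_def E2_def\<close>)+
    have "forest V1 E1 ends"
      by (rule forest_subgraph[OF less.prems]) (auto simp: E1_def V1_def)
    then have g1: "glued ends V1 E1" using less.hyps c by blast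
    have "forest (V - V1) E2 ends"
      by (rule forest_subgraph[OF less.prems _ _ E2]) (auto simp: E2_def)
    then have g2: "glued ends (V - V1) E2" using less.hyps c by blast
    have x: "x \<in> V1" "y \<notin> V1" using xy nr by (auto simp: V1_def)
    have "glued ends (V1 \<union> {x, y}) (E1 \<union> {e})"
    proof (rule glued_join[OF g1 glued_edge[of x y ends e]])
      have "V1 \<inter> {x, y} = {x}" using x by auto
      then show "card (V1 \<inter> {x, y}) \<le> 1" by simp
    qed (use ne xy in \<open>auto simp: E1_def\<close>)
    then have "glued ends (V1 \<union> {x, y} \<union> (V - V1)) (E1 \<union> {e} \<union> E2)"
    proof (rule glued_join[OF _ g2])
      have "(V1 \<union> {x, y}) \<inter> (V - V1) = {y}" using x xy by auto
      then show "card ((V1 \<union> {x, y}) \<inter> (V - V1)) \<le> 1" by simp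
    qed (auto simp: E2_def)
    moreover have "V1 \<union> {x, y} \<union> (V - V1) = V" using xy by (auto simp: V1_def)
    moreover have "E1 \<union> {e} \<union> E2 = E" using e by (auto simp: E1_def E2_def)
    ultimately show ?thesis by simp
  qed
qed

text \<open>Both operations replace an edge by a two-edge graph with the same terminals: a path
  through the new vertex, or a pair of parallel edges.\<close>

lemma sp_derived_glued: "sp_derived V E ends \<Longrightarrow> glued ends V E"
proof (induction rule: sp_derived.induct)
  case (sp_forest V E ends)
  then show ?case by (rule forest_glued)
next
  case (sp_series V E ends e x y w e1 e2)
  let ?ends = "ends(e1 := {x, w}, e2 := {w, y})"
  note b = glued_basic[OF sp_series.IH]
  have xy: "x \<noteq> y" "x \<in> V" "y \<in> V"
    using b sp_series.hyps(2,3) by (auto simp: loopless_def wf_graph_def)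
  then have w: "x \<noteq> w" "w \<noteq> y" using sp_series.hyps(4) by auto
  have i: "{x, w} \<inter> {w, y} = {w}" using xy w by auto
  have i1: "card ({x, w} \<inter> {w, y}) \<le> 1" unfolding i by simp
  have e12: "{e1} \<inter> {e2} = {}" using sp_series.hyps(7) by simp
  have en: "?ends e1 = {x, w}" "?ends e2 = {w, y}" using sp_series.hyps by auto
  have t: "tsp ?ends ({x, w} \<union> {w, y}, {e1} \<union> {e2}, x, y)"
    by (rule tsp_serI[OF tsp_K2[of x w ?ends e1, OF w(1) en(1)]
        tsp_K2[of w y ?ends e2, OF w(2) en(2)] i e12])
  have g: "glued ?ends ({x, w} \<union> {w, y}) ({e1} \<union> {e2})"
    by (rule glued_join[OF glued_edge[of x w ?ends e1, OF w(1) en(1)]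
        glued_edge[of w y ?ends e2, OF w(2) en(2)] i1 e12])
  have "glued ?ends (V \<union> ({x, w} \<union> {w, y})) (E - {e} \<union> ({e1} \<union> {e2}))"
    by (rule glued_substitute[OF sp_series.IH sp_series.hyps(2,3) t g]) (use sp_series.hyps xy in auto)
  moreover have "V \<union> ({x, w} \<union> {w, y}) = insert w V" "{e1} \<union> {e2} = {e1, e2}" using xy by auto
  ultimately show ?case by metis
next
  case (sp_parallel V E ends e e1 e2)
  let ?ends = "ends(e1 := ends e, e2 := ends e)"
  note b = glued_basic[OF sp_parallel.IH]
  obtain x y where e: "ends e = {x, y}" "x \<in> V" "y \<in> V" using wf_graph_ends b sp_parallel.hyps(2) by metis
  have ne: "x \<noteq> y" using b sp_parallel.hyps(2) e by (auto simp: loopless_def)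
  have en: "?ends e1 = {x, y}" "?ends e2 = {x, y}" using sp_parallel.hyps e by auto
  note K = tsp_K2[of x y ?ends e1, OF ne en(1)] tsp_K2[of x y ?ends e2, OF ne en(2)]
  have i: "{x, y} \<inter> {x, y} = {x, y}" "{e1} \<inter> {e2} = {}" using sp_parallel.hyps by auto
  have "glued ?ends (V \<union> ({x, y} \<union> {x, y})) (E - {e} \<union> ({e1} \<union> {e2}))"
    by (rule glued_substitute[OF sp_parallel.IH sp_parallel.hyps(2) e(1) tsp_parI[OF K i] glued_par[OF K i]])
      (use sp_parallel.hyps e in auto)
  moreover have "V \<union> ({x, y} \<union> {x, y}) = V" "{e1} \<union> {e2} = {e1, e2}" using e by auto
  ultimately show ?case by metis
qed

lemma series_parallel_glued: "series_parallel V E ends \<Longrightarrow> glued ends V E"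
  unfolding series_parallel_def by (blast intro: glued_cong dest: sp_derived_glued)

section \<open>Non-vanishing of the Tutte polynomial\<close>

lemma lambda_le_maxmaxflow:
  assumes "finite V" "x \<in> V" "y \<in> V" "x \<noteq> y"
  shows "lambda E ends x y \<le> maxmaxflow V E ends"
proof -
  have "{x, y} \<subseteq> V" "card {x, y} = 2" using assms by auto
  then have "\<not> card V < 2" using card_mono[OF assms(1)] by (metis not_less)
  moreover have "finite {lambda E ends x y | x y. x \<in> V \<and> y \<in> V \<and> x \<noteq> y}"
    by (rule finite_subset[of _ "(\<lambda>(x, y). lambda E ends x y) ` (V \<times> V)"]) (use assms in auto)
  ultimately show ?thesis unfolding maxmaxflow_def using assms by (auto intro!: Max_ge)
qed

context weight_sets
begin

lemma glued_tutte_nonzero: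
  assumes q1: "- q \<notin> S (L - 1)"
    and q2: "\<And>k l a b. 1 \<le> k \<Longrightarrow> 1 \<le> l \<Longrightarrow> k + l = L \<Longrightarrow> a \<in> S k \<Longrightarrow> b \<in> S l \<Longrightarrow> - q \<noteq> par_conn a b"
    and "glued ends V E"
    and "\<And>x y. x \<in> V \<Longrightarrow> y \<in> V \<Longrightarrow> x \<noteq> y \<Longrightarrow> lambda E ends x y \<le> L" "\<forall>e\<in>E. v e \<in> S 1"
  shows "tutte V E ends q v \<noteq> 0"
  using assms(3-)
proof (induction rule: glued.induct)
  case (glued_edgeless V)
  then show ?case using q0 by (simp add: tutte_def)
next
  case (glued_edge s t e)
  \<comment> \<open>Here L \<ge> 2 puts the index 1 into the admissible range.\<close>
  have "S 1 \<subseteq> S (L - 1)" by (rule S_mono) (use L2 in auto)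
  then have "q + v e \<noteq> 0" using glued_edge q1 by (metis add.commute add_eq_0_iff insertI1 subsetD)
  moreover have "tutte {s, t} {e} ends q v = q * (q + v e)"
    using tutte_partA_partB[OF q0, of "{e}" "{s, t}" ends v s t] part_edge[of q s t ends e v] q0 glued_edge
    by (simp add: power2_eq_square algebra_simps)
  ultimately show ?case using q0 by simp
next
  case (glued_par V1 E1 s t V2 E2)
  note X = glued_par(1-4)
  note b1 = tsp_basic[OF X(1)] and b2 = tsp_basic[OF X(2)]
  have fin: "finite E1" "finite E2" using b1 b2 by (auto simp: wf_graph_def)
  \<comment> \<open>Each side of the block serves as the outside connection of the other.\<close>
  have "good ends v V1 E1 s t \<and> lambda E1 ends s t \<le> L - 1"
    by (rule good_if_outside_connection[OF X(1) fin(2)]) (use b2 glued_par(4-) in auto)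
  moreover have "good ends v V2 E2 s t \<and> lambda E2 ends s t \<le> L - 1"
    by (rule good_if_outside_connection[OF X(2) fin(1)])
      (use b1 glued_par(4-) in \<open>auto simp: Un_commute\<close>)
  ultimately have g: "good ends v V1 E1 s t" "good ends v V2 E2 s t" by auto
  define w where "w = partB (V1 \<union> V2) (E1 \<union> E2) ends s t q v / partA (V1 \<union> V2) (E1 \<union> E2) ends s t q v"
  have A: "partA (V1 \<union> V2) (E1 \<union> E2) ends s t q v \<noteq> 0"
    and w: "w = par_conn (partB V1 E1 ends s t q v / partA V1 E1 ends s t q v)
        (partB V2 E2 ends s t q v / partA V2 E2 ends s t q v)"
    using parallel_weight[OF X] g by (auto simp: good_def w_def)
  have pos: "1 \<le> lambda E1 ends s t" "1 \<le> lambda E2 ends s t" using tsp_lambda_pos X by metis+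
  have lam: "lambda (E1 \<union> E2) ends s t = lambda E1 ends s t + lambda E2 ends s t"
    by (rule tsp_lambda_parallel[OF X])
  have "lambda (E1 \<union> E2) ends s t \<le> L" using glued_par(5) b1 by blast
  \<comment> \<open>Flow below L places the weight of the block in a set S, where (3) applies. Flow
    exactly L leaves the range of condition (2), but the weight is still a parallel connection with
    indices summing to L, which is case (4).\<close>
  then consider "lambda (E1 \<union> E2) ends s t \<le> L - 1" | "lambda E1 ends s t + lambda E2 ends s t = L"
    unfolding lam by linarith
  then have "- q \<noteq> w"
  proof cases
    case 1
    then have "w \<in> S (lambda (E1 \<union> E2) ends s t)"
      using good_parallel[OF X g] by (simp add: good_def w_def)
    moreover have "S (lambda (E1 \<union> E2) ends s t) \<subseteq> S (L - 1)"
      by (rule S_mono) (use 1 pos lam in auto)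
    ultimately show ?thesis using q1 by auto
  next
    case 2
    then show ?thesis unfolding w using q2 pos g by (auto simp: good_def)
  qed
  then have "q + w \<noteq> 0" by (metis minus_unique)
  moreover have "tutte (V1 \<union> V2) (E1 \<union> E2) ends q v = q * partA (V1 \<union> V2) (E1 \<union> E2) ends s t q v * (q + w)"
    using tutte_partA_partB[OF q0, of "E1 \<union> E2" "V1 \<union> V2" ends v s t] fin A
    by (simp add: w_def power2_eq_square algebra_simps)
  ultimately show ?case using A q0 by simp
next
  case (glued_join V1 E1 V2 E2)
  note b1 = glued_basic[OF glued_join(1)] and b2 = glued_basic[OF glued_join(2)]
  have fin: "finite (E1 \<union> E2)" using b1 b2 by (auto simp: wf_graph_def)
  \<comment> \<open>Each part inherits the bound because its flows are at most those of the whole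
    graph.\<close>
  have l: "lambda F ends x y \<le> L" if "F \<subseteq> E1 \<union> E2" "x \<in> V1 \<union> V2" "y \<in> V1 \<union> V2" "x \<noteq> y" for F x y
    using lambda_mono[OF fin that(1,4)] glued_join.prems(1)[OF that(2-4)] by (rule order_trans)
  have "tutte V1 E1 ends q v \<noteq> 0"
    by (rule glued_join.IH(1)) (use l glued_join.prems(2) in auto)
  moreover have "tutte V2 E2 ends q v \<noteq> 0"
    by (rule glued_join.IH(2)) (use l glued_join.prems(2) in auto)
  moreover have "q ^ card (V1 \<inter> V2) * tutte (V1 \<union> V2) (E1 \<union> E2) ends q v =
      tutte V1 E1 ends q v * tutte V2 E2 ends q v"
    by (rule tutte_Un_separated) (use b1 b2 glued_join in auto)
  ultimately show ?case by auto
qed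

end

theorem theorem4p1:
  fixes q :: complex and L :: nat and S :: "nat \<Rightarrow> complex set"
  assumes hq: "q \<noteq> 0"
    and hL: "L \<ge> 2"
    and hmono: "\<forall>k. 1 \<le> k \<and> k < L - 1 \<longrightarrow> S k \<subseteq> S (Suc k)"
    and h1: "\<forall>k l a b. 1 \<le> k \<and> k \<le> L - 1 \<and> 1 \<le> l \<and> l \<le> L - 1 \<and> a \<in> S k \<and> b \<in> S l
               \<longrightarrow> q + a + b \<noteq> 0 \<and> ser_conn q a b \<in> S (min k l)"
    and h2: "\<forall>k l a b. 1 \<le> k \<and> 1 \<le> l \<and> k + l \<le> L - 1 \<and> a \<in> S k \<and> b \<in> S l
               \<longrightarrow> par_conn a b \<in> S (k + l)"
  shows "(\<forall>(ends :: 'e \<Rightarrow> 'v set) (G :: ('v, 'e) tgraph) T (v :: 'e \<Rightarrow> complex).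
            tsp ends G \<and> decomp_tree ends G T \<and> maximal_dtree ends T \<and>
            (\<forall>(Vh, Eh, a, b) \<in> proper_nodes T. lambda Eh ends a b \<le> L - 1) \<and>
            (\<forall>e \<in> fst (snd G). v e \<in> S 1)
            \<longrightarrow> (\<forall>(Vh, Eh, a, b) \<in> nodes T. lambda Eh ends a b \<le> L - 1 \<longrightarrow>
                   partA Vh Eh ends a b q v \<noteq> 0 \<and>
                   partB Vh Eh ends a b q v / partA Vh Eh ends a b q v \<in> S (lambda Eh ends a b)))
       \<and> ((- q \<notin> S (L - 1) \<and>
           (\<forall>k l. 1 \<le> k \<and> 1 \<le> l \<and> k + l = L \<longrightarrow>
              - q \<notin> {par_conn a b | a b. a \<in> S k \<and> b \<in> S l}))
          \<longrightarrow> (\<forall>(V :: 'v set) (E :: 'e set) ends (v :: 'e \<Rightarrow> complex).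
                series_parallel V E ends \<and> maxmaxflow V E ends \<le> L \<and> (\<forall>e\<in>E. v e \<in> S 1)
                \<longrightarrow> tutte V E ends q v \<noteq> 0))"
proof -
  interpret weight_sets q L S
    by unfold_locales (use assms in auto)
  show ?thesis
  proof (intro conjI allI impI)
    fix ends :: "'e \<Rightarrow> 'v set" and G :: "('v, 'e) tgraph" and T v
    assume h: "tsp ends G \<and> decomp_tree ends G T \<and> maximal_dtree ends T \<and>
            (\<forall>(Vh, Eh, a, b) \<in> proper_nodes T. lambda Eh ends a b \<le> L - 1) \<and>
            (\<forall>e \<in> fst (snd G). v e \<in> S 1)"
    obtain V E s t where G: "G = (V, E, s, t)" by (metis prod_cases4)
    then have T: "wf_dtree ends V E T" "lab T = G" using h by (auto simp: decomp_tree_def)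
    have "good ends v Vh Eh a b" if "(Vh, Eh, a, b) \<in> nodes T" "lambda Eh ends a b \<le> L - 1" for Vh Eh a b
      by (rule good_nodes[OF T(1) _ _ _ _ that]) (use h T in auto)
    then show "\<forall>(Vh, Eh, a, b) \<in> nodes T. lambda Eh ends a b \<le> L - 1 \<longrightarrow>
                   partA Vh Eh ends a b q v \<noteq> 0 \<and>
                   partB Vh Eh ends a b q v / partA Vh Eh ends a b q v \<in> S (lambda Eh ends a b)"
      by (auto simp: good_def)
  next
    fix V :: "'v set" and E :: "'e set" and ends and v :: "'e \<Rightarrow> complex"
    assume q: "- q \<notin> S (L - 1) \<and> (\<forall>k l. 1 \<le> k \<and> 1 \<le> l \<and> k + l = L \<longrightarrow>
              - q \<notin> {par_conn a b | a b. a \<in> S k \<and> b \<in> S l})"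
      and h: "series_parallel V E ends \<and> maxmaxflow V E ends \<le> L \<and> (\<forall>e\<in>E. v e \<in> S 1)"
    have g: "glued ends V E" using h series_parallel_glued by blast
    then have "finite V" using glued_basic by (auto simp: wf_graph_def)
    then have "lambda E ends x y \<le> L" if "x \<in> V" "y \<in> V" "x \<noteq> y" for x y
      using lambda_le_maxmaxflow[OF _ that] h order_trans by blast
    then show "tutte V E ends q v \<noteq> 0"
      using q h by (intro glued_tutte_nonzero[OF _ _ g]) blast+
  qed
qed

end
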